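(* Let $0<\alpha<1$, let $U\subseteq\mathbb{C}$ be open, and let $x_0\in\partial U$. Suppose $U$ satisfies a cone condition at $x_0$, and let $J$ be a non-tangential ray to $x_0$ (the midline of the cone). Let $t$ be a non-negative integer and let $0<\lambda<1$. If $$\sum_{n=1}^{\infty} 2^{(t+1+\lambda)n}\, M_*^{1+\alpha}(A_n\setminus U)<\infty,$$ then there is a constant $C>0$ such that $$\frac{|f^{(t)}(x)-f^{(t)}(x_0)|}{|x-x_0|^{\lambda}}\le C\,\|f\|_{\mathrm{Lip}\alpha(\mathbb{C})}$$ for all $x\in J$ (with $x\neq x_0$) and all $f\in A_\alpha(U)$.
   Context: For $0<\alpha<1$, $\mathrm{Lip}\alpha(\mathbb{C})$ is the space of functions $f:\mathbb{C}\to\mathbb{C}$ for which there is $k>0$ with $|f(z)-f(w)|\le k|z-w|^\alpha$ for all $z,w$; its norm is $\|f\|_{\mathrm{Lip}\alpha(\mathbb{C})}=\sup|f|+k(f)$, where $k(f)$ is the smallest such $k$. The little Lipschitz class $\mathrm{lip}\alpha(\mathbb{C})$ consists of those $f\in\mathrm{Lip}\alpha(\mathbb{C})$ such that for each $\epsilon>0$ there is $\delta>0$ with $|f(z)-f(w)|\le\epsilon|z-w|^\alpha$ whenever $|z-w|<\delta$. $A_\alpha(U)$ denotes the space of functions in $\mathrm{lip}\alpha(\mathbb{C})$ that are analytic on $U$, with the norm $\|\cdot\|_{\mathrm{Lip}\alpha(\mathbb{C})}$. $A_n=\{z: 2^{-n-1}<|z-x_0|<2^{-n}\}$. A measure function is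 a nondecreasing $h:[0,\infty)\to[0,\infty)$; $M_h(E)=\inf\sum h(\operatorname{diam}B)$, the infimum over all countable covers of $E$ by balls $B$. The lower $(1+\alpha)$-dimensional Hausdorff content is $M_*^{1+\alpha}(E)=\sup M_h(E)$, the supremum over measure functions $h$ with $h(r)\le r^{1+\alpha}$ and $r^{-1-\alpha}h(r)\to0$ as $r\to0$. Cone condition: there is an open sector (cone) $\mathscr{C}$ with vertex $x_0$, contained in $U$ near $x_0$, with midline segment $J$ starting at $x_0$, and a constant $K>0$ such that $|x-x_0|\le K|z-x|$ whenever $x\in J$ and $z\notin\mathscr{C}$; $J$ is then called a non-tangential ray to $x_0$. The value $f^{(t)}(x_0)$ for $f\in A_\alpha(U)$: functions in $A_\alpha(U)$ analytic in a neighbourhood of $x_0$ are dense in $A_\alpha(U)$, and under the hypothesis the map $f\mapsto f^{(t)}(x_0)$ on that dense subspace is bounded (a bounded point derivation of order $t$) and extends continuously to $A_\alpha(U)$; $f^{(t)}(x_0)$ denotes this extension. *)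

theory Defs
  imports "HOL-Analysis.Analysis"
begin

definition Lip :: "real \<Rightarrow> (complex \<Rightarrow> complex) set" where
  "Lip \<alpha> = {f. bounded (range f) \<and>
      (\<exists>k>0. \<forall>z w. cmod (f z - f w) \<le> k * cmod (z - w) powr \<alpha>)}"

definition lip :: "real \<Rightarrow> (complex \<Rightarrow> complex) set" where
  "lip \<alpha> = {f. f \<in> Lip \<alpha> \<and>
      (\<forall>\<epsilon>>0. \<exists>\<delta>>0. \<forall>z w. cmod (z - w) < \<delta> \<longrightarrow>
          cmod (f z - f w) \<le> \<epsilon> * cmod (z - w) powr \<alpha>)}"

definition lip_const :: "real \<Rightarrow> (complex \<Rightarrow> complex) \<Rightarrow> real" where
  "lip_const \<alpha> f = (SUP p \<in> {(z, w). z \<noteq> w}.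
      cmod (f (fst p) - f (snd p)) / cmod (fst p - snd p) powr \<alpha>)"

definition lip_norm :: "real \<Rightarrow> (complex \<Rightarrow> complex) \<Rightarrow> real" where
  "lip_norm \<alpha> f = (SUP z. cmod (f z)) + lip_const \<alpha> f"

definition A_alpha :: "real \<Rightarrow> complex set \<Rightarrow> (complex \<Rightarrow> complex) set" where
  "A_alpha \<alpha> U = {f. f \<in> lip \<alpha> \<and> f holomorphic_on U}"

definition A_alpha_near :: "real \<Rightarrow> complex set \<Rightarrow> complex \<Rightarrow> (complex \<Rightarrow> complex) set" where
  "A_alpha_near \<alpha> U x0 = {f. f \<in> A_alpha \<alpha> U \<and>
      (\<exists>N. open N \<and> x0 \<in> N \<and> f holomorphic_on N)}"

text \<open>v is the value at f of the continuous extension of g \<mapsto> g^(t)(x0)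
  from the dense subspace A_alpha_near to A_alpha(U).\<close>
definition is_bpd_ext ::
  "real \<Rightarrow> complex set \<Rightarrow> complex \<Rightarrow> nat \<Rightarrow> (complex \<Rightarrow> complex) \<Rightarrow> complex \<Rightarrow> bool" where
  "is_bpd_ext \<alpha> U x0 t f v \<longleftrightarrow>
     (\<forall>g :: nat \<Rightarrow> complex \<Rightarrow> complex.
        (\<forall>n. g n \<in> A_alpha_near \<alpha> U x0) \<and>
        (\<lambda>n. lip_norm \<alpha> (\<lambda>z. g n z - f z)) \<longlonglongrightarrow> 0 \<longrightarrow>
        (\<lambda>n. (deriv ^^ t) (g n) x0) \<longlonglongrightarrow> v)"

definition measure_function :: "(real \<Rightarrow> real) \<Rightarrow> bool" where
  "measure_function h \<longleftrightarrow> mono_on {0..} h \<and> (\<forall>r\<ge>0. h r \<ge> 0)"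

text \<open>Countable covers by (closed) balls, indexed by nat; diam of cball c r is 2r.\<close>
definition hcontent :: "(real \<Rightarrow> real) \<Rightarrow> complex set \<Rightarrow> ennreal" where
  "hcontent h E = (INF cr \<in> {cr :: nat \<Rightarrow> complex \<times> real.
        (\<forall>n. snd (cr n) \<ge> 0) \<and> E \<subseteq> (\<Union>n. cball (fst (cr n)) (snd (cr n)))}.
      (\<Sum>n. ennreal (h (2 * snd (cr n)))))"

definition lower_content :: "real \<Rightarrow> complex set \<Rightarrow> ennreal" where
  "lower_content \<alpha> E = (SUP h \<in> {h. measure_function h \<and>
        (\<forall>r\<ge>0. h r \<le> r powr (1 + \<alpha>)) \<and>
        ((\<lambda>r. h r / r powr (1 + \<alpha>)) \<longlongrightarrow> 0) (at_right 0)}.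
      hcontent h E)"

definition annulus :: "complex \<Rightarrow> nat \<Rightarrow> complex set" where
  "annulus x0 n = {z. 2 powr (- real n - 1) < cmod (z - x0) \<and> cmod (z - x0) < 2 powr (- real n)}"

definition sector :: "complex \<Rightarrow> real \<Rightarrow> real \<Rightarrow> complex set" where
  "sector x0 \<theta>0 \<beta> = {z. \<exists>r>0. \<exists>\<theta>. \<bar>\<theta>\<bar> < \<beta> \<and> z = x0 + of_real r * cis (\<theta>0 + \<theta>)}"

end

theory Submission
  imports Defs "HOL-Complex_Analysis.Complex_Analysis"
begin

text \<open>
  Let \<open>x\<close>, \<open>y\<close> lie on the ray within distance \<open>d\<close> of \<open>x0\<close>. Up to a factor, the difference
  \<open>f^(t)(x) - f^(t)(y)\<close> is the integral of \<open>f g\<close> over the boundary of a fixed square around \<open>x0\<close>, with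
  \<open>g(z) = (z-x)^(-t-1) - (z-y)^(-t-1)\<close>, minus the same integral of \<open>f g\<close> with its poles removed. The
  cone condition gives \<open>|g(z)| \<le> C d^\<lambda> |z-x0|^(-t-1-\<lambda>)\<close> near the complement of \<open>U\<close>.

  The square is quadrisected until the pieces either lie in \<open>U\<close>, where Cauchy's theorem
  applies, or are comparable to a ball of a given finite cover of the complement of \<open>U\<close>. On a
  piece \<open>S\<close> of the second kind and of side \<open>s\<close>, \<open>f\<close> may be replaced by \<open>f - f(c)\<close>, which gives
  the bound \<open>s \<omega>(s) sup |g|\<close> for the modulus of continuity \<open>\<omega>\<close> of \<open>f\<close>. As \<open>f\<close> is in the little
  Lipschitz class, \<open>h(r) = r \<omega>(r) / \<parallel>f\<parallel>\<close> is itself one of the measure functions in the definition of the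
  lower content, so the cover can be chosen with \<open>h\<close>-sums controlled by the contents of the
  annuli. The circles between the annuli have content 0 because they are one-dimensional.

  Hence \<open>|f^(t)(x) - f^(t)(y)| \<le> C d^\<lambda> \<parallel>f\<parallel>\<close>, so \<open>f^(t)\<close> has a limit along the ray. This limit
  is bounded and linear in \<open>f\<close> and agrees with \<open>f^(t)(x0)\<close> if \<open>f\<close> is analytic near \<open>x0\<close>.
\<close>

section \<open>Integrals over squares\<close>

text \<open>Squares are given by the lower left corner, so that the quarters arise by shifting that
  corner by \<open>s/2\<close>.\<close>

definition csq :: "complex \<Rightarrow> real \<Rightarrow> complex set" where
  "csq c s = cbox c (c + Complex s s)"

definition sqint :: "(complex \<Rightarrow> complex) \<Rightarrow> complex \<Rightarrow> real \<Rightarrow> complex" where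
  "sqint F c s = contour_integral (rectpath c (c + Complex s s)) F"

lemma in_csq_iff:
  "z \<in> csq c s \<longleftrightarrow> Re c \<le> Re z \<and> Re z \<le> Re c + s \<and> Im c \<le> Im z \<and> Im z \<le> Im c + s"
  by (auto simp: csq_def in_cbox_complex_iff)

lemma convex_csq: "convex (csq c s)" and compact_csq: "compact (csq c s)"
  by (auto simp: csq_def)

text \<open>The crude factor 2 in place of sqrt 2 matches the argument \<open>2 * r\<close> at which
  the modulus of continuity is evaluated later.\<close>

lemma dist_csq_le:
  assumes "z \<in> csq c s" "w \<in> csq c s"
  shows "cmod (z - w) \<le> 2 * s"
proof -
  have "cmod (z - w) \<le> \<bar>Re (z - w)\<bar> + \<bar>Im (z - w)\<bar>" by (rule cmod_le)
  also have "\<dots> \<le> s + s"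
    using assms by (intro add_mono) (auto simp: in_csq_iff)
  finally show ?thesis by simp
qed

lemma path_image_sq: "0 \<le> s \<Longrightarrow> path_image (rectpath c (c + Complex s s)) \<subseteq> csq c s"
  unfolding csq_def by (rule path_image_rectpath_subset_cbox) auto

lemma rectpath_square:
  "rectpath c (c + Complex s s) = linepath c (c + Complex s 0)
      +++ linepath (c + Complex s 0) (c + Complex s s)
      +++ linepath (c + Complex s s) (c + Complex 0 s) +++ linepath (c + Complex 0 s) c"
proof -
  have "Complex (Re (c + Complex s s)) (Im c) = c + Complex s 0"
    "Complex (Re c) (Im (c + Complex s s)) = c + Complex 0 s"
    by (auto simp: complex_eq_iff)
  then show ?thesis unfolding rectpath_def Let_def by metis
qed

lemma path_image_square:
  "path_image (rectpath c (c + Complex s s)) = closed_segment c (c + Complex s 0)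
      \<union> closed_segment (c + Complex s 0) (c + Complex s s)
      \<union> closed_segment (c + Complex s s) (c + Complex 0 s) \<union> closed_segment (c + Complex 0 s) c"
  unfolding rectpath_square by (auto simp: path_image_join)

lemma sqint_sides:
  assumes "continuous_on (path_image (rectpath c (c + Complex s s))) F"
  shows "sqint F c s = contour_integral (linepath c (c + Complex s 0)) F
      + contour_integral (linepath (c + Complex s 0) (c + Complex s s)) F
      + contour_integral (linepath (c + Complex s s) (c + Complex 0 s)) F
      + contour_integral (linepath (c + Complex 0 s) c) F"
    and "F contour_integrable_on (rectpath c (c + Complex s s))"
proof -
  have I: "F contour_integrable_on (linepath c (c + Complex s 0))"
    "F contour_integrable_on (linepath (c + Complex s 0) (c + Complex s s))"
    "F contour_integrable_on (linepath (c + Complex s s) (c + Complex 0 s))"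
    "F contour_integrable_on (linepath (c + Complex 0 s) c)"
    using assms unfolding path_image_square
    by (auto intro!: contour_integrable_continuous_linepath elim: continuous_on_subset)
  show "F contour_integrable_on (rectpath c (c + Complex s s))"
    unfolding rectpath_square using I by (auto intro!: contour_integrable_joinI valid_path_join)
  show "sqint F c s = contour_integral (linepath c (c + Complex s 0)) F
      + contour_integral (linepath (c + Complex s 0) (c + Complex s s)) F
      + contour_integral (linepath (c + Complex s s) (c + Complex 0 s)) F
      + contour_integral (linepath (c + Complex 0 s) c) F"
    unfolding sqint_def rectpath_square using I
    by (simp add: contour_integral_join contour_integrable_joinI valid_path_join)
qed

lemma norm_sqint_le:
  assumes cont: "continuous_on (path_image (rectpath c (c + Complex s s))) F" and "0 \<le> s" "0 \<le> B"
    and B: "\<And>z. z \<in> path_image (rectpath c (c + Complex s s)) \<Longrightarrow> cmod (F z) \<le> B"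
  shows "cmod (sqint F c s) \<le> 4 * s * B"
proof -
  have *: "cmod (contour_integral (linepath a b) F) \<le> B * cmod (b - a)"
    if "closed_segment a b \<subseteq> path_image (rectpath c (c + Complex s s))" for a b
  proof (rule contour_integral_bound_linepath)
    show "F contour_integrable_on linepath a b"
      using that cont by (intro contour_integrable_continuous_linepath) (rule continuous_on_subset)
  qed (use that B assms in auto)
  have n: "cmod (Complex s 0) = s" "cmod (Complex 0 s) = s" "cmod (Complex (-s) 0) = s" "cmod (Complex 0 (-s)) = s"
    using assms(2) by (auto simp: complex_norm)
  have d: "c + Complex s 0 - c = Complex s 0" "c + Complex s s - (c + Complex s 0) = Complex 0 s"
     "c + Complex 0 s - (c + Complex s s) = Complex (-s) 0" "c - (c + Complex 0 s) = Complex 0 (-s)"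
    by (auto simp: complex_eq_iff)
  have "cmod (contour_integral (linepath c (c + Complex s 0)) F) \<le> B * s"
    "cmod (contour_integral (linepath (c + Complex s 0) (c + Complex s s)) F) \<le> B * s"
    "cmod (contour_integral (linepath (c + Complex s s) (c + Complex 0 s)) F) \<le> B * s"
    "cmod (contour_integral (linepath (c + Complex 0 s) c) F) \<le> B * s"
    using *[of c "c + Complex s 0"] *[of "c + Complex s 0" "c + Complex s s"]
     *[of "c + Complex s s" "c + Complex 0 s"] *[of "c + Complex 0 s" c]
    unfolding d n path_image_square by blast+
  then have "cmod (sqint F c s) \<le> B * s + B * s + B * s + B * s"
    unfolding sqint_sides(1)[OF cont] by (intro norm_triangle_mono)
  then show ?thesis by (simp add: algebra_simps)
qed

text \<open>Each of the four inner edges is traversed twice in opposite directions, so only the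
  halves of the outer sides survive.\<close>

lemma sqint_quadrisect:
  assumes "continuous_on (csq c s) F" "0 \<le> s"
  shows "sqint F c s = sqint F c (s/2) + sqint F (c + Complex (s/2) 0) (s/2)
     + sqint F (c + Complex 0 (s/2)) (s/2) + sqint F (c + Complex (s/2) (s/2)) (s/2)"
proof -
  define u where "u = s/2"
  have s: "s = u + u" "0 \<le> u" using assms(2) by (auto simp: u_def)
  let ?L = "\<lambda>a b. contour_integral (linepath a b) F"
  have cont: "continuous_on (closed_segment a b) F" if "a \<in> csq c s" "b \<in> csq c s" for a b
    by (meson assms(1) closed_segment_subset continuous_on_subset convex_csq that)
  have split: "?L a b = ?L a m + ?L m b"
    if "a \<in> csq c s" "b \<in> csq c s" "m = midpoint a b" for a b m
    unfolding that(3) by (rule contour_integral_split_linepath) (use cont that in auto)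
  have rev: "?L a b = - ?L b a" if "a \<in> csq c s" "b \<in> csq c s" for a b
    by (rule contour_integral_reverse_linepath) (use cont that in auto)
  have sub: "csq (c + Complex a b) u \<subseteq> csq c s" if "a \<in> {0,u}" "b \<in> {0,u}" for a b
    using that s by (auto simp: in_csq_iff)
  have c4: "continuous_on (csq (c + Complex a b) u) F" if "a \<in> {0,u}" "b \<in> {0,u}" for a b
    by (rule continuous_on_subset[OF assms(1) sub[OF that]])
  \<comment> \<open>All edges join neighbouring points of this 3 by 3 grid, so that after splitting
    and reversing segments the claim is a linear identity.\<close>
  define p where "p i j = c + Complex (i * u) (j * u)" for i j :: real
  have sq: "sqint F (p i j) u = ?L (p i j) (p (i+1) j) + ?L (p (i+1) j) (p (i+1) (j+1))
      + ?L (p (i+1) (j+1)) (p i (j+1)) + ?L (p i (j+1)) (p i j)" if "i \<in> {0,1}" "j \<in> {0,1}" for i j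
  proof -
    have "continuous_on (csq (p i j) u) F"
      unfolding p_def using that by (intro c4) auto
    then have "continuous_on (path_image (rectpath (p i j) (p i j + Complex u u))) F"
      using path_image_sq[OF s(2)] continuous_on_subset by blast
    moreover have "p i j + Complex u 0 = p (i+1) j" "p i j + Complex u u = p (i+1) (j+1)"
      "p i j + Complex 0 u = p i (j+1)"
      by (auto simp: p_def complex_eq_iff algebra_simps)
    ultimately show ?thesis using sqint_sides(1)[of "p i j" u F] by simp
  qed
  have pin: "p i j \<in> csq c s" if "i \<in> {0,1,2}" "j \<in> {0,1,2}" for i j
    using s that by (auto simp: p_def in_csq_iff)
  have big: "sqint F c s = ?L (p 0 0) (p 2 0) + ?L (p 2 0) (p 2 2) + ?L (p 2 2) (p 0 2) + ?L (p 0 2) (p 0 0)"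
    using sqint_sides(1)[OF continuous_on_subset[OF assms(1) path_image_sq[OF assms(2)]]]
    by (simp add: p_def s Complex_eq_0 flip: zero_complex.code)
  have mids: "?L (p 0 0) (p 2 0) = ?L (p 0 0) (p 1 0) + ?L (p 1 0) (p 2 0)"
    "?L (p 2 0) (p 2 2) = ?L (p 2 0) (p 2 1) + ?L (p 2 1) (p 2 2)"
    "?L (p 2 2) (p 0 2) = ?L (p 2 2) (p 1 2) + ?L (p 1 2) (p 0 2)"
    "?L (p 0 2) (p 0 0) = ?L (p 0 2) (p 0 1) + ?L (p 0 1) (p 0 0)"
    by (intro split pin; simp add: p_def midpoint_def complex_eq_iff)+
  have revs: "?L (p 1 1) (p 0 1) = - ?L (p 0 1) (p 1 1)" "?L (p 1 0) (p 1 1) = - ?L (p 1 1) (p 1 0)"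
    "?L (p 2 1) (p 1 1) = - ?L (p 1 1) (p 2 1)" "?L (p 1 1) (p 1 2) = - ?L (p 1 2) (p 1 1)"
    by (intro rev pin; simp)+
  have e: "sqint F c u = sqint F (p 0 0) u" "sqint F (c + Complex u 0) u = sqint F (p 1 0) u"
    "sqint F (c + Complex 0 u) u = sqint F (p 0 1) u" "sqint F (c + Complex u u) u = sqint F (p 1 1) u"
    by (auto simp: p_def simp flip: zero_complex.code)
  have sqs: "sqint F (p 0 0) u = ?L (p 0 0) (p 1 0) + ?L (p 1 0) (p 1 1) + ?L (p 1 1) (p 0 1) + ?L (p 0 1) (p 0 0)"
    "sqint F (p 1 0) u = ?L (p 1 0) (p 2 0) + ?L (p 2 0) (p 2 1) + ?L (p 2 1) (p 1 1) + ?L (p 1 1) (p 1 0)"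
    "sqint F (p 0 1) u = ?L (p 0 1) (p 1 1) + ?L (p 1 1) (p 1 2) + ?L (p 1 2) (p 0 2) + ?L (p 0 2) (p 0 1)"
    "sqint F (p 1 1) u = ?L (p 1 1) (p 2 1) + ?L (p 2 1) (p 2 2) + ?L (p 2 2) (p 1 2) + ?L (p 1 2) (p 1 1)"
    using sq[of 0 0] sq[of 1 0] sq[of 0 1] sq[of 1 1] by simp_all
  show ?thesis
    unfolding big u_def[symmetric] mids e sqs revs by algebra
qed

lemma sqint_holomorphic_eq_0:
  assumes "F holomorphic_on csq c s" "0 \<le> s"
  shows "sqint F c s = 0"
  unfolding sqint_def
  by (rule contour_integral_unique, rule Cauchy_theorem_convex_simple[OF assms(1) convex_csq])
    (use path_image_sq[OF assms(2)] in auto)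

section \<open>Areas of half-open squares\<close>

definition hsq :: "complex \<Rightarrow> real \<Rightarrow> complex set" where
  "hsq c s = {z. Re c \<le> Re z \<and> Re z < Re c + s \<and> Im c \<le> Im z \<and> Im z < Im c + s}"

lemma hsq_sets [measurable, simp]: "hsq c s \<in> sets borel"
proof -
  have "hsq c s = {z. Re c \<le> Re z} \<inter> {z. Re z < Re c + s} \<inter> {z. Im c \<le> Im z} \<inter> {z. Im z < Im c + s}"
    by (auto simp: hsq_def)
  moreover have "closed {z. Re c \<le> Re z}" "open {z. Re z < Re c + s}" "closed {z. Im c \<le> Im z}" "open {z. Im z < Im c + s}"
    by (intro closed_Collect_le open_Collect_less continuous_intros)+
  ultimately show ?thesis by (simp add: borel_open borel_closed)
qed

lemma measure_cbox_square:
  assumes "0 \<le> s" shows "measure lborel (cbox c (c + Complex s s)) = s\<^sup>2"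
    "measure lborel (box c (c + Complex s s)) = s\<^sup>2"
  using assms by (simp_all add: measure_lborel_cbox_eq measure_lborel_box_eq Basis_complex_def power2_eq_square inner_complex_def)

lemma measure_hsq_ge:
  assumes "0 \<le> s" shows "s\<^sup>2 \<le> measure lborel (hsq c s)"
proof -
  have "measure lborel (box c (c + Complex s s)) \<le> measure lborel (hsq c s)"
  proof (rule measure_mono_fmeasurable)
    show "hsq c s \<in> fmeasurable lborel"
    proof (rule fmeasurableI2)
      show "cbox c (c + Complex s s) \<in> fmeasurable lborel" by simp
    qed (auto simp: hsq_def in_cbox_complex_iff)
  qed (auto simp: hsq_def in_box_complex_iff)
  then show ?thesis using measure_cbox_square[OF assms] by simp
qed

lemma measure_ball_le:
  assumes "0 \<le> r" shows "measure lborel (ball (c::complex) r) \<le> 4 * r\<^sup>2"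
proof -
  have "measure lborel (ball c r) \<le> measure lborel (cbox (c - Complex r r) ((c - Complex r r) + Complex (2*r) (2*r)))"
  proof (rule measure_mono_fmeasurable)
    show "ball c r \<subseteq> cbox (c - Complex r r) (c - Complex r r + Complex (2 * r) (2 * r))"
    proof
      fix z assume "z \<in> ball c r"
      then have "cmod (z - c) < r" by (simp add: dist_norm norm_minus_commute)
      then have "\<bar>Re (z - c)\<bar> < r" "\<bar>Im (z - c)\<bar> < r"
        using abs_Re_le_cmod abs_Im_le_cmod by (meson le_less_trans)+
      then show "z \<in> cbox (c - Complex r r) (c - Complex r r + Complex (2 * r) (2 * r))"
        by (auto simp: in_cbox_complex_iff)
    qed
  qed auto
  also have "\<dots> = (2*r)\<^sup>2" by (rule measure_cbox_square) (use assms in auto)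
  finally show ?thesis by (simp add: power2_eq_square)
qed

text \<open>Half-open quarters are disjoint, so their areas add up; intersecting with a ball models
  a density supported on that ball. For negative \<open>s\<close> all quarters are empty.\<close>

lemma measure_hsq_quadrisect:
  "measure lborel (hsq c (s/2) \<inter> ball a r) + measure lborel (hsq (c + Complex (s/2) 0) (s/2) \<inter> ball a r)
   + measure lborel (hsq (c + Complex 0 (s/2)) (s/2) \<inter> ball a r)
   + measure lborel (hsq (c + Complex (s/2) (s/2)) (s/2) \<inter> ball a r)
   \<le> measure lborel (hsq c s \<inter> ball a r)"
proof (cases "0 \<le> s")
  case True
  let ?A = "hsq c (s/2) \<inter> ball a r" and ?B = "hsq (c + Complex (s/2) 0) (s/2) \<inter> ball a r"
  let ?C = "hsq (c + Complex 0 (s/2)) (s/2) \<inter> ball a r" and ?D = "hsq (c + Complex (s/2) (s/2)) (s/2) \<inter> ball a r"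
  have fm: "hsq c s \<inter> ball a r \<in> fmeasurable lborel" for c s
  proof (rule fmeasurableI2[of "ball a r"])
    show "ball a r \<in> fmeasurable lborel"
      using emeasure_lborel_ball_finite[of a r] by (intro fmeasurableI) (auto simp: less_top)
    show "hsq c s \<inter> ball a r \<in> sets lborel" by simp
  qed auto
  have "measure lborel (?A \<union> ?B) = measure lborel ?A + measure lborel ?B"
    by (rule measure_Un_AE[OF AE_I2 fm fm]) (auto simp: hsq_def)
  moreover have "measure lborel (?C \<union> ?D) = measure lborel ?C + measure lborel ?D"
    by (rule measure_Un_AE[OF AE_I2 fm fm]) (auto simp: hsq_def)
  moreover have "measure lborel ((?A \<union> ?B) \<union> (?C \<union> ?D)) = measure lborel (?A \<union> ?B) + measure lborel (?C \<union> ?D)"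
    by (rule measure_Un_AE[OF AE_I2 fmeasurable.Un[OF fm fm] fmeasurable.Un[OF fm fm]]) (auto simp: hsq_def)
  moreover have "measure lborel ((?A \<union> ?B) \<union> (?C \<union> ?D)) \<le> measure lborel (hsq c s \<inter> ball a r)"
  proof (rule measure_mono_fmeasurable[OF _ _ fm])
    show "(?A \<union> ?B) \<union> (?C \<union> ?D) \<subseteq> hsq c s \<inter> ball a r"
      using True by (auto simp: hsq_def)
    show "(?A \<union> ?B) \<union> (?C \<union> ?D) \<in> sets lborel"
      by simp
  qed
  ultimately show ?thesis by linarith
next
  case False
  then have "hsq z (s/2) = {}" for z by (auto simp: hsq_def)
  then show ?thesis by simp
qed

section \<open>Stopping-time estimate over a cover of the singularities\<close>

text \<open>Quadrisection stops at a square that meets some ball \<open>j\<close> with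
  \<open>s \<le> r j < 2 * s\<close>, where \<open>est\<close> applies; squares meeting no ball lie
  in \<open>U\<close> and contribute 0. Stopped squares charged to one ball do not overlap, have
  area at least \<open>(r j)^2 / 4\<close> and lie in the threefold ball, of area at most
  \<open>36 * (r j)^2\<close>. The quotient is 144.\<close>

lemma norm_sqint_le_sum_cover:
  fixes c :: "'i \<Rightarrow> complex" and r w :: "'i \<Rightarrow> real"
  assumes T: "finite T" and cont: "continuous_on (csq c0 s0) F" and hol: "F holomorphic_on U"
    and cover: "csq c0 s0 - U \<subseteq> (\<Union>j\<in>T. ball (c j) (r j))"
    and pos: "\<And>j. j \<in> T \<Longrightarrow> 0 < r j" and w: "\<And>j. j \<in> T \<Longrightarrow> 0 \<le> w j"
    and small: "\<And>j. j \<in> T \<Longrightarrow> r j < s0" and "0 < s0"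
    and est: "\<And>j a s. j \<in> T \<Longrightarrow> csq a s \<subseteq> csq c0 s0 \<Longrightarrow> csq a s \<inter> ball (c j) (r j) \<noteq> {} \<Longrightarrow>
        s \<le> r j \<Longrightarrow> r j < 2 * s \<Longrightarrow> cmod (sqint F a s) \<le> w j"
  shows "cmod (sqint F c0 s0) \<le> 144 * (\<Sum>j\<in>T. w j)"
proof -
  \<comment> \<open>The weights are spread out as a density on the enlarged balls, so that the count of
    stopped squares per ball becomes an area comparison.\<close>
  define \<mu> where "\<mu> a s = (\<Sum>j\<in>T. 4 * w j / (r j)\<^sup>2 * measure lborel (hsq a s \<inter> ball (c j) (3 * r j)))" for a s
  have \<mu>0: "0 \<le> \<mu> a s" for a s
    unfolding \<mu>_def by (intro sum_nonneg mult_nonneg_nonneg divide_nonneg_nonneg) (use w in auto)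
  have \<mu>add: "\<mu> a (s/2) + \<mu> (a + Complex (s/2) 0) (s/2) + \<mu> (a + Complex 0 (s/2)) (s/2)
      + \<mu> (a + Complex (s/2) (s/2)) (s/2) \<le> \<mu> a s" for a s
    unfolding \<mu>_def sum.distrib[symmetric] distrib_left[symmetric]
    by (intro sum_mono mult_left_mono measure_hsq_quadrisect divide_nonneg_nonneg mult_nonneg_nonneg) (use w in auto)
  \<comment> \<open>A stopped square has diameter at most \<open>2 * s \<le> 2 * r j\<close>, so it
    lies in the threefold ball and its whole area counts towards the summand of
    \<open>j\<close>.\<close>
  have \<mu>stop: "w j \<le> \<mu> a s"
    if j: "j \<in> T" and meet: "csq a s \<inter> ball (c j) (r j) \<noteq> {}" and s: "s \<le> r j" "r j < 2 * s" for j a s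
  proof -
    obtain p where p: "p \<in> csq a s" "dist (c j) p < r j" using meet by auto
    have "0 < r j" using pos j by auto
    have sub: "hsq a s \<subseteq> ball (c j) (3 * r j)"
    proof
      fix z assume "z \<in> hsq a s"
      then have "z \<in> csq a s" by (auto simp: hsq_def in_csq_iff)
      with p have "cmod (z - p) \<le> 2 * s" by (intro dist_csq_le)
      then have "dist p z \<le> 2 * r j" using s by (simp add: dist_norm norm_minus_commute)
      with p(2) have "dist (c j) z < 3 * r j" using dist_triangle[of "c j" z p] by linarith
      then show "z \<in> ball (c j) (3 * r j)" by simp
    qed
    have "(r j)\<^sup>2 \<le> (2 * s)\<^sup>2" using s \<open>0 < r j\<close> by (intro power_mono) auto
    also have "\<dots> \<le> 4 * measure lborel (hsq a s)"
      using measure_hsq_ge[of s a] s \<open>0 < r j\<close> by (simp add: power2_eq_square)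
    finally have "w j * (r j)\<^sup>2 \<le> w j * (4 * measure lborel (hsq a s))"
      using w[OF j] by (intro mult_left_mono)
    then have "w j \<le> 4 * w j / (r j)\<^sup>2 * measure lborel (hsq a s \<inter> ball (c j) (3 * r j))"
      using \<open>0 < r j\<close> sub by (simp add: Int_absorb2 field_simps)
    also have "\<dots> \<le> \<mu> a s"
      unfolding \<mu>_def using w T j
      by (intro member_le_sum[where f = "\<lambda>j. 4 * w j / (r j)\<^sup>2 * measure lborel (hsq a s \<inter> ball (c j) (3 * r j))"]) auto
    finally show ?thesis .
  qed
  \<comment> \<open>Inserting \<open>s0\<close> keeps the minimum meaningful for empty
    \<open>T\<close>.\<close>
  define \<delta> where "\<delta> = Min (insert s0 (r ` T))"
  have \<delta>: "0 < \<delta>" and \<delta>r: "\<And>j. j \<in> T \<Longrightarrow> \<delta> \<le> r j"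
    unfolding \<delta>_def using T pos \<open>0 < s0\<close> by (auto simp: Min_gr_iff)
  \<comment> \<open>The last premise says that the square is not yet stopped: every ball that it
    meets is smaller than its side. The number \<open>n\<close> bounds the remaining depth.\<close>
  have main: "cmod (sqint F a s) \<le> \<mu> a s"
    if "0 < s" "s \<le> \<delta> * 2 ^ n" "csq a s \<subseteq> csq c0 s0"
      "\<forall>j\<in>T. csq a s \<inter> ball (c j) (r j) \<noteq> {} \<longrightarrow> r j < s" for n a s
    using that
  proof (induction n arbitrary: a s)
    case 0
    \<comment> \<open>At depth 0 the side is at most every radius, so an unstopped square meets no
      ball at all.\<close>
    then have "csq a s \<inter> ball (c j) (r j) = {}" if "j \<in> T" for j
      using \<delta>r[OF that] that by force
    then have "csq a s \<subseteq> U" using 0(3) cover by blast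
    then have "sqint F a s = 0"
      using hol 0 by (intro sqint_holomorphic_eq_0) (auto intro: holomorphic_on_subset)
    then show ?case using \<mu>0 by simp
  next
    case (Suc n)
    have child: "cmod (sqint F b (s/2)) \<le> \<mu> b (s/2)" if sub: "csq b (s/2) \<subseteq> csq a s" for b
    proof (cases "\<forall>j\<in>T. csq b (s/2) \<inter> ball (c j) (r j) \<noteq> {} \<longrightarrow> r j < s/2")
      case True
      show ?thesis by (rule Suc.IH) (use Suc.prems sub True in auto)
    next
      case False
      then obtain j where j: "j \<in> T" "csq b (s/2) \<inter> ball (c j) (r j) \<noteq> {}" "s/2 \<le> r j" by force
      \<comment> \<open>As the parent was not stopped, a child that violates the premise is within
        the factor 2 that \<open>est\<close> and \<open>\<mu>stop\<close> require.\<close>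
      moreover have "r j < s" using j Suc.prems(4) sub by blast
      ultimately show ?thesis
        using est[of j b "s/2"] \<mu>stop[of j b "s/2"] sub Suc.prems(3) by fastforce
    qed
    have sub: "csq a (s/2) \<subseteq> csq a s" "csq (a + Complex (s/2) 0) (s/2) \<subseteq> csq a s"
      "csq (a + Complex 0 (s/2)) (s/2) \<subseteq> csq a s" "csq (a + Complex (s/2) (s/2)) (s/2) \<subseteq> csq a s"
      using Suc.prems(1) by (auto simp: in_csq_iff)
    have "sqint F a s = sqint F a (s/2) + sqint F (a + Complex (s/2) 0) (s/2)
     + sqint F (a + Complex 0 (s/2)) (s/2) + sqint F (a + Complex (s/2) (s/2)) (s/2)"
      by (rule sqint_quadrisect) (use Suc.prems cont in \<open>auto intro: continuous_on_subset\<close>)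
    also have "cmod \<dots> \<le> \<mu> a (s/2) + \<mu> (a + Complex (s/2) 0) (s/2) + \<mu> (a + Complex 0 (s/2)) (s/2)
      + \<mu> (a + Complex (s/2) (s/2)) (s/2)"
      by (intro norm_triangle_mono child sub)
    also have "\<dots> \<le> \<mu> a s" by (rule \<mu>add)
    finally show ?case .
  qed
  obtain n where "s0 / \<delta> < 2 ^ n"
    using real_arch_pow[of 2 "s0/\<delta>"] by auto
  then have "s0 \<le> \<delta> * 2 ^ n" using \<delta> by (simp add: field_simps)
  \<comment> \<open>By \<open>small\<close> the initial square is itself not stopped.\<close>
  then have "cmod (sqint F c0 s0) \<le> \<mu> c0 s0"
    using main[of s0 n c0] small \<open>0 < s0\<close> by auto
  also have "\<dots> \<le> (\<Sum>j\<in>T. 144 * w j)"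
    unfolding \<mu>_def
  proof (rule sum_mono)
    fix j assume j: "j \<in> T"
    have "measure lborel (hsq c0 s0 \<inter> ball (c j) (3 * r j)) \<le> measure lborel (ball (c j) (3 * r j))"
      using emeasure_lborel_ball_finite[of "c j" "3 * r j"]
      by (intro measure_mono_fmeasurable fmeasurableI) (auto simp: less_top intro!: sets.Int)
    also have "\<dots> \<le> 4 * (3 * r j)\<^sup>2" using pos[OF j] by (intro measure_ball_le) auto
    finally have "4 * w j / (r j)\<^sup>2 * measure lborel (hsq c0 s0 \<inter> ball (c j) (3 * r j))
      \<le> 4 * w j / (r j)\<^sup>2 * (4 * (3 * r j)\<^sup>2)"
      using w[OF j] by (intro mult_left_mono) auto
    also have "\<dots> = 144 * w j" using pos[OF j] by (simp add: power2_eq_square)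
    finally show "4 * w j / (r j)\<^sup>2 * measure lborel (hsq c0 s0 \<inter> ball (c j) (3 * r j)) \<le> 144 * w j" .
  qed
  finally show ?thesis by (simp add: sum_distrib_left)
qed

section \<open>Modulus of continuity and Hausdorff content\<close>

text \<open>The modulus of continuity as a real supremum: boundedness of \<open>f\<close> makes the
  values bounded above, and \<open>r \<ge> 0\<close> makes the index set nonempty.\<close>

definition modulus :: "(complex \<Rightarrow> complex) \<Rightarrow> real \<Rightarrow> real" where
  "modulus f r = (SUP p \<in> {(z, w). cmod (z - w) \<le> r}. cmod (f (fst p) - f (snd p)))"

lemma modulus_upper:
  assumes "\<And>z. cmod (f z) \<le> M" "cmod (z - w) \<le> r"
  shows "cmod (f z - f w) \<le> modulus f r"
proof -
  have "cmod (f a - f b) \<le> M + M" for a b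
    using norm_triangle_ineq4[of "f a" "f b"] assms(1)[of a] assms(1)[of b] by linarith
  then have "bdd_above ((\<lambda>p. cmod (f (fst p) - f (snd p))) ` {(z, w). cmod (z - w) \<le> r})"
    by (intro bdd_aboveI[where M = "M + M"]) auto
  from cSUP_upper[OF _ this, of "(z, w)"] show ?thesis
    using assms(2) by (simp add: modulus_def)
qed

lemma modulus_least:
  assumes "0 \<le> r" "\<And>z w. cmod (z - w) \<le> r \<Longrightarrow> cmod (f z - f w) \<le> B"
  shows "modulus f r \<le> B"
  unfolding modulus_def
proof (rule cSUP_least)
  have "(0, 0) \<in> {(z, w). cmod (z - w) \<le> r}" using assms(1) by simp
  then show "{(z, w). cmod (z - w) \<le> r} \<noteq> {}" by blast
qed (use assms in auto)

lemma modulus_nonneg: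
  assumes "\<And>z. cmod (f z) \<le> M" "0 \<le> r"
  shows "0 \<le> modulus f r"
  using modulus_upper[of f M 0 0 r] assms by simp

lemma modulus_mono:
  assumes "\<And>z. cmod (f z) \<le> M" "0 \<le> r" "r \<le> s"
  shows "modulus f r \<le> modulus f s"
  by (rule modulus_least) (use assms in \<open>auto intro: modulus_upper[OF assms(1)]\<close>)

text \<open>Pass through the midpoint, which is within \<open>r\<close> of both points.\<close>

lemma modulus_double:
  assumes "\<And>z. cmod (f z) \<le> M" "0 \<le> r"
  shows "modulus f (2 * r) \<le> 2 * modulus f r"
proof (rule modulus_least)
  fix z w assume zw: "cmod (z - w) \<le> 2 * r"
  let ?m = "midpoint z w"
  have "z - ?m = (z - w) /\<^sub>R 2" "?m - w = (z - w) /\<^sub>R 2"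
    by (auto simp: midpoint_def scaleR_conv_of_real field_simps)
  then have "cmod (z - ?m) \<le> r" "cmod (?m - w) \<le> r" using zw by simp_all
  then have "cmod (f z - f ?m) \<le> modulus f r" "cmod (f ?m - f w) \<le> modulus f r"
    using assms(1) by (auto intro: modulus_upper)
  moreover have "cmod (f z - f w) \<le> cmod (f z - f ?m) + cmod (f ?m - f w)"
    using norm_triangle_ineq[of "f z - f ?m" "f ?m - f w"] by simp
  ultimately show "cmod (f z - f w) \<le> 2 * modulus f r" by linarith
qed (use assms in auto)

text \<open>Up to constants this is the perimeter of a square times the oscillation of
  \<open>f\<close> on it; dividing by a Lipschitz bound \<open>M\<close> makes it admissible in the
  lower content.\<close>

definition lip_gauge :: "real \<Rightarrow> (complex \<Rightarrow> complex) \<Rightarrow> real \<Rightarrow> real" where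
  "lip_gauge M f r = r * modulus f r / M"

text \<open>\<open>M\<close> is any common bound for the supremum and the Lipschitz constant, not
  the norm itself, so that it stays positive for \<open>f = 0\<close>.\<close>

locale lip_fun =
  fixes \<alpha> M :: real and f :: "complex \<Rightarrow> complex"
  assumes \<alpha>: "0 < \<alpha>" "\<alpha> < 1" and f_lip: "f \<in> lip \<alpha>" and M: "0 < M"
    and f_le: "\<And>z. cmod (f z) \<le> M"
    and f_diff: "\<And>z w. cmod (f z - f w) \<le> M * cmod (z - w) powr \<alpha>"
begin

lemma modulus_le_powr: "0 \<le> r \<Longrightarrow> modulus f r \<le> M * r powr \<alpha>"
proof (rule modulus_least)
  fix z w assume "cmod (z - w) \<le> r"
  then have "cmod (z - w) powr \<alpha> \<le> r powr \<alpha>" using \<alpha> by (intro powr_mono2) auto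
  then show "cmod (f z - f w) \<le> M * r powr \<alpha>"
    using f_diff[of z w] M by (meson less_imp_le mult_left_mono order_trans)
qed auto

lemma gauge_le_powr:
  assumes "0 \<le> r" shows "lip_gauge M f r \<le> r powr (1 + \<alpha>)"
proof -
  have "r * modulus f r \<le> r * (M * r powr \<alpha>)"
    using modulus_le_powr assms by (intro mult_left_mono) auto
  then show ?thesis using M assms
    by (cases "r = 0") (auto simp: lip_gauge_def powr_add field_simps)
qed

lemma gauge_nonneg: "0 \<le> r \<Longrightarrow> 0 \<le> lip_gauge M f r"
  using modulus_nonneg[OF f_le] M by (simp add: lip_gauge_def)

lemma gauge_mono: "0 \<le> r \<Longrightarrow> r \<le> s \<Longrightarrow> lip_gauge M f r \<le> lip_gauge M f s"
  unfolding lip_gauge_def using modulus_mono[OF f_le, of r s] modulus_nonneg[OF f_le, of r] M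
  by (intro divide_right_mono mult_mono) auto

text \<open>One factor 2 comes from \<open>r\<close>, the other from the modulus. Doubling is what
  turning closed balls into open ones will cost.\<close>

lemma gauge_double: "0 \<le> r \<Longrightarrow> lip_gauge M f (2 * r) \<le> 4 * lip_gauge M f r"
proof -
  assume r: "0 \<le> r"
  have "(2 * r) * modulus f (2 * r) \<le> (2 * r) * (2 * modulus f r)"
    using modulus_double[OF f_le r] r by (intro mult_left_mono) auto
  then show ?thesis using M by (simp add: lip_gauge_def field_simps)
qed

text \<open>Here the little Lipschitz condition enters: it beats the bound
  \<open>M * r powr \<alpha>\<close> by an arbitrarily small factor at small scales. The factor 1/2
  leaves room for the strict inequality.\<close>

lemma gauge_tendsto: "((\<lambda>r. lip_gauge M f r / r powr (1 + \<alpha>)) \<longlongrightarrow> 0) (at_right 0)"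
proof (rule tendstoI)
  fix e :: real assume e: "0 < e"
  have "0 < e * M / 2" using e M by simp
  then obtain d where d: "d > 0" "\<And>z w. cmod (z - w) < d \<Longrightarrow> cmod (f z - f w) \<le> e * M / 2 * cmod (z - w) powr \<alpha>"
    using f_lip unfolding lip_def by blast
  have "dist (lip_gauge M f r / r powr (1 + \<alpha>)) 0 < e" if r: "0 < r" "r < d" for r
  proof -
    have "modulus f r \<le> e * M / 2 * r powr \<alpha>"
    proof (rule modulus_least)
      fix z w assume zw: "cmod (z - w) \<le> r"
      then have "cmod (z - w) powr \<alpha> \<le> r powr \<alpha>" using \<alpha> by (intro powr_mono2) auto
      then have "e * M / 2 * cmod (z - w) powr \<alpha> \<le> e * M / 2 * r powr \<alpha>" using e M by (intro mult_left_mono) auto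
      then show "cmod (f z - f w) \<le> e * M / 2 * r powr \<alpha>" using d(2)[of z w] zw r by linarith
    qed (use r in auto)
    then have "lip_gauge M f r / r powr (1 + \<alpha>) \<le> e / 2"
      using r M by (simp add: lip_gauge_def powr_add field_simps)
    moreover have "0 \<le> lip_gauge M f r / r powr (1 + \<alpha>)" using gauge_nonneg[of r] r by simp
    ultimately show ?thesis using e unfolding dist_real_def by linarith
  qed
  then show "\<forall>\<^sub>F r in at_right 0. dist (lip_gauge M f r / r powr (1 + \<alpha>)) 0 < e"
    using d(1) by (auto simp: eventually_at_right)
qed

lemma hcontent_gauge_le: "hcontent (lip_gauge M f) E \<le> lower_content \<alpha> E"
  unfolding lower_content_def
proof (rule SUP_upper)
  show "lip_gauge M f \<in> {h. measure_function h \<and> (\<forall>r\<ge>0. h r \<le> r powr (1 + \<alpha>)) \<and>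
        ((\<lambda>r. h r / r powr (1 + \<alpha>)) \<longlongrightarrow> 0) (at_right 0)}"
    using gauge_nonneg gauge_mono gauge_le_powr gauge_tendsto
    by (auto simp: measure_function_def mono_on_def)
qed

end

text \<open>Open balls allow compactness arguments; bounding all finite partial sums by
  \<open>b\<close> replaces an infinite sum over a set of balls. Each ball has to meet
  \<open>E\<close>, so that it lies near a point of \<open>E\<close>.\<close>

definition fine_cover :: "(real \<Rightarrow> real) \<Rightarrow> real \<Rightarrow> complex set \<Rightarrow> real \<Rightarrow> bool" where
  "fine_cover h R E b \<longleftrightarrow> (\<exists>\<B>. E \<subseteq> (\<Union>p\<in>\<B>. ball (fst p) (snd p)) \<and>
     (\<forall>p\<in>\<B>. 0 < snd p \<and> snd p \<le> R \<and> ball (fst p) (snd p) \<inter> E \<noteq> {}) \<and>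
     (\<forall>T\<subseteq>\<B>. finite T \<longrightarrow> (\<Sum>p\<in>T. h (2 * snd p)) \<le> b))"

text \<open>Balls missing \<open>E\<close> are discarded, which preserves both the covering and the
  bound on the sums.\<close>

lemma fine_coverI:
  assumes "E \<subseteq> (\<Union>p\<in>\<B>. ball (fst p) (snd p))" "\<And>p. p \<in> \<B> \<Longrightarrow> 0 < snd p \<and> snd p \<le> R"
    and "\<And>T. T \<subseteq> \<B> \<Longrightarrow> finite T \<Longrightarrow> (\<Sum>p\<in>T. h (2 * snd p)) \<le> b"
  shows "fine_cover h R E b"
  unfolding fine_cover_def
proof (intro exI[of _ "{p \<in> \<B>. ball (fst p) (snd p) \<inter> E \<noteq> {}}"] conjI)
  show "E \<subseteq> (\<Union>p\<in>{p \<in> \<B>. ball (fst p) (snd p) \<inter> E \<noteq> {}}. ball (fst p) (snd p))"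
    using assms(1) by blast
  show "\<forall>T\<subseteq>{p \<in> \<B>. ball (fst p) (snd p) \<inter> E \<noteq> {}}. finite T \<longrightarrow> (\<Sum>p\<in>T. h (2 * snd p)) \<le> b"
    by (intro allI impI assms(3)) blast+
qed (use assms(2) in blast)

lemma fine_cover_Un:
  assumes "fine_cover h R E b" "fine_cover h R E' b'"
  shows "fine_cover h R (E \<union> E') (b + b')"
proof -
  from assms(1) obtain B where B: "E \<subseteq> (\<Union>p\<in>B. ball (fst p) (snd p))"
    "\<And>p. p \<in> B \<Longrightarrow> 0 < snd p \<and> snd p \<le> R"
    "\<And>T. T \<subseteq> B \<Longrightarrow> finite T \<Longrightarrow> (\<Sum>p\<in>T. h (2 * snd p)) \<le> b"
    unfolding fine_cover_def by auto
  from assms(2) obtain B' where B': "E' \<subseteq> (\<Union>p\<in>B'. ball (fst p) (snd p))"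
    "\<And>p. p \<in> B' \<Longrightarrow> 0 < snd p \<and> snd p \<le> R"
    "\<And>T. T \<subseteq> B' \<Longrightarrow> finite T \<Longrightarrow> (\<Sum>p\<in>T. h (2 * snd p)) \<le> b'"
    unfolding fine_cover_def by auto
  show ?thesis
  proof (rule fine_coverI[of _ "B \<union> B'"])
    fix T assume T: "T \<subseteq> B \<union> B'" "finite T"
    have "(\<Sum>p\<in>T. h (2 * snd p)) = (\<Sum>p\<in>T \<inter> B. h (2 * snd p)) + (\<Sum>p\<in>T - B. h (2 * snd p))"
      using T sum.Int_Diff[of T _ B] by blast
    also have "\<dots> \<le> b + b'" using T by (intro add_mono B(3) B'(3)) auto
    finally show "(\<Sum>p\<in>T. h (2 * snd p)) \<le> b + b'" .
  next
    show "E \<union> E' \<subseteq> (\<Union>p\<in>B \<union> B'. ball (fst p) (snd p))" using B(1) B'(1) by (simp add: UN_Un le_supI1 le_supI2)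
    show "\<And>p. p \<in> B \<union> B' \<Longrightarrow> 0 < snd p \<and> snd p \<le> R" using B(2) B'(2) by (meson UnE)
  qed
qed

lemma cmod_diff_cis_le: "cmod (cis a - cis b) \<le> \<bar>a - b\<bar>"
proof -
  have "cis a - cis b = cis b * (exp (\<i> * of_real (a - b)) - 1)"
    by (simp add: right_diff_distrib cis_mult flip: cis_conv_exp of_real_diff)
  then have "cmod (cis a - cis b) = 2 * \<bar>sin ((a - b) / 2)\<bar>"
    by (simp only: norm_mult norm_cis dist_exp_i_1)
  also have "\<dots> \<le> 2 * \<bar>(a - b) / 2\<bar>" by (intro mult_left_mono abs_sin_x_le_abs_x) auto
  finally show ?thesis by simp
qed

text \<open>Since \<open>7 > 2 * pi\<close>, \<open>N\<close> balls of radius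
  \<open>7 * q / N\<close> centred at equally spaced points cover the circle. Their total cost is at
  most a constant times \<open>N powr (- \<alpha>)\<close>, which tends to 0.\<close>

lemma fine_cover_sphere:
  assumes "0 < \<alpha>" and h: "\<And>r. 0 \<le> r \<Longrightarrow> h r \<le> r powr (1 + \<alpha>)"
    and "0 < q" "0 < R" "0 < \<delta>" and E: "E \<subseteq> sphere x0 q"
  shows "fine_cover h R E \<delta>"
proof -
  have "(\<lambda>n. (14 * q) powr (1 + \<alpha>) * real n powr (- \<alpha>)) \<longlonglongrightarrow> (14 * q) powr (1 + \<alpha>) * 0"
    using \<open>0 < \<alpha>\<close> by (intro tendsto_intros tendsto_neg_powr filterlim_real_sequentially) auto
  then have "\<forall>\<^sub>F n in sequentially. (14 * q) powr (1 + \<alpha>) * real n powr (- \<alpha>) < \<delta>"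
    using \<open>0 < \<delta>\<close> by (auto dest!: order_tendstoD(2)[of _ _ _ \<delta>])
  moreover have "(\<lambda>n. (7 * q) / real n) \<longlonglongrightarrow> 0"
    by (intro tendsto_divide_0[OF tendsto_const] filterlim_at_top_imp_at_infinity filterlim_real_sequentially)
  then have "\<forall>\<^sub>F n in sequentially. (7 * q) / real n < R"
    using \<open>0 < R\<close> by (auto dest!: order_tendstoD(2)[of _ _ _ R])
  moreover have "\<forall>\<^sub>F n in sequentially. 0 < (n::nat)" by (rule eventually_gt_at_top)
  ultimately obtain N where N: "(14 * q) powr (1 + \<alpha>) * real N powr (- \<alpha>) < \<delta>" "(7 * q) / real N < R" "0 < N"
    using eventually_happens'[OF sequentially_bot, OF eventually_conj[OF _ eventually_conj]] by blast
  define P where "P k = (x0 + of_real q * cis (2 * pi * real k / real N), 7 * q / real N)" for k :: nat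
  show ?thesis
  proof (rule fine_coverI[of _ "P ` {..<N}"])
    show "E \<subseteq> (\<Union>p\<in>P ` {..<N}. ball (fst p) (snd p))"
    proof
      fix z assume "z \<in> E"
      then have "cmod (z - x0) = q" using E by (auto simp: dist_norm norm_minus_commute)
      then have z: "z = x0 + of_real q * cis (Arg2pi (z - x0))"
        using Arg2pi_eq[of "z - x0"] by (simp add: cis_conv_exp algebra_simps)
      define \<theta> where "\<theta> = Arg2pi (z - x0)"
      have \<theta>: "0 \<le> \<theta>" "\<theta> < 2 * pi" by (auto simp: \<theta>_def Arg2pi_ge_0 Arg2pi_lt_2pi)
      define k where "k = nat \<lfloor>\<theta> * N / (2 * pi)\<rfloor>"
      have k: "real k \<le> \<theta> * N / (2 * pi)" "\<theta> * N / (2 * pi) < real k + 1"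
        using \<theta> unfolding k_def by (simp_all add: of_nat_nat)
      have "\<theta> * N / (2 * pi) < N" using \<theta> N(3) by (simp add: field_simps)
      then have "k < N" using k(1) by linarith
      have "\<bar>\<theta> - 2 * pi * real k / real N\<bar> \<le> 2 * pi / N"
      proof -
        have "2 * pi * real k / real N \<le> \<theta>" using k(1) N(3) by (simp add: field_simps)
        moreover have "\<theta> \<le> 2 * pi * real k / real N + 2 * pi / N"
          using k(2) N(3) by (simp add: field_simps)
        ultimately show ?thesis by linarith
      qed
      then have "cmod (cis \<theta> - cis (2 * pi * real k / real N)) \<le> 2 * pi / N"
        using cmod_diff_cis_le by (meson order_trans)
      also have "\<dots> < 7 / N" using pi_less_4 N(3) by (intro divide_strict_right_mono) (use pi_approx in auto)
      finally have "q * cmod (cis \<theta> - cis (2 * pi * real k / real N)) < q * (7 / N)"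
        using \<open>0 < q\<close> by (intro mult_strict_left_mono)
      moreover have "cmod (z - fst (P k)) = q * cmod (cis \<theta> - cis (2 * pi * real k / real N))"
      proof -
        have "z - fst (P k) = of_real q * (cis \<theta> - cis (2 * pi * real k / real N))"
          by (subst z) (simp add: P_def \<theta>_def algebra_simps)
        then show ?thesis using \<open>0 < q\<close> by (simp add: norm_mult)
      qed
      ultimately have "z \<in> ball (fst (P k)) (snd (P k))"
        by (simp add: P_def dist_norm norm_minus_commute mult.commute)
      with \<open>k < N\<close> show "z \<in> (\<Union>p\<in>P ` {..<N}. ball (fst p) (snd p))" by blast
    qed
    show "0 < snd p \<and> snd p \<le> R" if "p \<in> P ` {..<N}" for p
      using that N \<open>0 < q\<close> by (auto simp: P_def)
    fix T assume T: "T \<subseteq> P ` {..<N}" "finite T"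
    have "(\<Sum>p\<in>T. h (2 * snd p)) \<le> (\<Sum>p\<in>T. (14 * q / N) powr (1 + \<alpha>))"
    proof (rule sum_mono)
      fix p assume "p \<in> T"
      then have "snd p = 7 * q / N" using T by (auto simp: P_def)
      then show "h (2 * snd p) \<le> (14 * q / N) powr (1 + \<alpha>)" using h[of "2 * snd p"] \<open>0 < q\<close> by simp
    qed
    also have "\<dots> = real (card T) * (14 * q / N) powr (1 + \<alpha>)" by simp
    also have "\<dots> \<le> N * (14 * q / N) powr (1 + \<alpha>)"
      using card_mono[OF _ T(1)] card_image_le[of "{..<N}" P] by (intro mult_right_mono) auto
    also have "\<dots> = (14 * q) powr (1 + \<alpha>) * real N powr (- \<alpha>)"
      using N(3) \<open>0 < q\<close> by (simp add: powr_divide powr_add powr_minus field_simps)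
    finally show "(\<Sum>p\<in>T. h (2 * snd p)) \<le> \<delta>" using N(1) by simp
  qed
qed

text \<open>A cover of cost below \<open>A\<close> becomes an open one of cost at most
  \<open>5 * A\<close>: 4 from doubling, 1 from degenerate balls. If all its radii are at most
  \<open>\<epsilon> * R\<close>, it serves. Otherwise one large ball already shows that a ball of
  radius \<open>\<epsilon> * R\<close> costs at most \<open>5 * A\<close>, and \<open>card P\<close>
  such balls cover \<open>cball x0 R\<close>.\<close>

lemma fine_cover_hcontent:
  fixes P :: "complex set"
  assumes h: "measure_function h" and dbl: "\<And>r. 0 \<le> r \<Longrightarrow> h (2 * r) \<le> 4 * h r"
    and small: "\<And>r. 0 \<le> r \<Longrightarrow> r \<le> 1 \<Longrightarrow> h r \<le> r"
    and E: "E \<subseteq> cball x0 R" and R: "0 < R" and \<epsilon>: "0 < \<epsilon>"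
    and P: "finite P" "cball 0 1 \<subseteq> (\<Union>p\<in>P. ball p \<epsilon>)"
    and A: "hcontent h E < ennreal A"
  shows "fine_cover h (\<epsilon> * R) E ((real (card P) + 1) * (5 * A))"
proof -
  have A0: "0 < A" using A by (metis ennreal_eq_0_iff not_le not_less_zero)
  have h0: "0 \<le> h r" and hm: "r \<le> s \<Longrightarrow> h r \<le> h s" if "0 \<le> r" for r s
    using h that by (auto simp: measure_function_def mono_on_def)
  obtain cr where cr: "\<And>n. snd (cr n) \<ge> 0" "E \<subseteq> (\<Union>n. cball (fst (cr n)) (snd (cr n)))"
    "(\<Sum>n. ennreal (h (2 * snd (cr n)))) < ennreal A"
    using A unfolding hcontent_def INF_less_iff by blast
  \<comment> \<open>Points cannot be doubled, so zero radii become tiny positive ones: the bound 1/2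
    makes \<open>small\<close> applicable to \<open>2 * r n\<close>, and the powers of 2 keep the
    total extra cost at most \<open>A\<close>.\<close>
  define r where "r n = (if snd (cr n) = 0 then min (1/2) (A / 2 ^ (n + 2)) else 2 * snd (cr n))" for n
  have r0: "0 < r n" for n using cr(1)[of n] A0 by (auto simp: r_def)
  have hr: "h (2 * r n) \<le> 4 * h (2 * snd (cr n)) + A * (1/2) ^ Suc n" for n
  proof (cases "snd (cr n) = 0")
    case True
    have "h (2 * r n) \<le> 2 * r n" using True A0 by (intro small) (auto simp: r_def)
    also have "\<dots> \<le> A * (1/2) ^ Suc n" using True by (auto simp: r_def min_def field_simps)
    finally show ?thesis using h0[of "2 * snd (cr n)"] cr(1)[of n] by simp
  next
    case False
    then show ?thesis using dbl[of "2 * snd (cr n)"] cr(1)[of n] A0 by (simp add: r_def add_increasing2)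
  qed
  have sums: "(\<Sum>n\<in>I. h (2 * r n)) \<le> 5 * A" if I: "finite I" for I
  proof -
    have "ennreal (\<Sum>n\<in>I. h (2 * snd (cr n))) = (\<Sum>n\<in>I. ennreal (h (2 * snd (cr n))))"
      using h0 cr(1) by (simp add: sum_ennreal)
    also have "\<dots> \<le> (\<Sum>n. ennreal (h (2 * snd (cr n))))"
      by (rule sum_le_suminf) (use I in auto)
    also have "\<dots> \<le> ennreal A" using cr(3) by simp
    finally have 1: "(\<Sum>n\<in>I. h (2 * snd (cr n))) \<le> A" using A0 by (simp add: ennreal_le_iff)
    have "(\<Sum>n\<in>I. (1/2::real) ^ Suc n) \<le> (\<Sum>n. (1/2) ^ Suc n)"
      using power_half_series I by (intro sum_le_suminf) (auto simp: sums_iff)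
    also have "\<dots> = 1" using power_half_series by (simp add: sums_iff)
    finally have 2: "A * (\<Sum>n\<in>I. (1/2::real) ^ Suc n) \<le> A * 1" using A0 by (intro mult_left_mono) auto
    have "(\<Sum>n\<in>I. h (2 * r n)) \<le> (\<Sum>n\<in>I. 4 * h (2 * snd (cr n)) + A * (1/2) ^ Suc n)"
      by (intro sum_mono hr)
    also have "\<dots> = 4 * (\<Sum>n\<in>I. h (2 * snd (cr n))) + A * (\<Sum>n\<in>I. (1/2::real) ^ Suc n)"
      by (simp only: sum.distrib sum_distrib_left)
    finally show ?thesis using 1 2 by linarith
  qed
  show ?thesis
  proof (cases "\<forall>n. r n \<le> \<epsilon> * R")
    case True
    show ?thesis
    proof (rule fine_coverI[of _ "range (\<lambda>n. (fst (cr n), r n))"])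
      show "E \<subseteq> (\<Union>p\<in>range (\<lambda>n. (fst (cr n), r n)). ball (fst p) (snd p))"
      proof
        fix z assume "z \<in> E"
        then obtain n where "z \<in> cball (fst (cr n)) (snd (cr n))" using cr(2) by auto
        moreover have "snd (cr n) < r n" using r0[of n] cr(1)[of n] by (auto simp: r_def)
        ultimately have "z \<in> ball (fst (cr n)) (r n)" by simp
        then show "z \<in> (\<Union>p\<in>range (\<lambda>n. (fst (cr n), r n)). ball (fst p) (snd p))" by auto
      qed
      fix T assume T: "T \<subseteq> range (\<lambda>n. (fst (cr n), r n))" "finite T"
      from finite_subset_image[OF T(2,1)] obtain I where I: "finite I" "T = (\<lambda>n. (fst (cr n), r n)) ` I"
        by auto
      \<comment> \<open>Different indices may give the same ball, so the sum over the image is only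
        bounded by the sum over \<open>I\<close>.\<close>
      have "(\<Sum>p\<in>T. h (2 * snd p)) \<le> (\<Sum>n\<in>I. h (2 * r n))"
        unfolding I(2) using I(1) h0 r0

        by (intro order_trans[OF sum_image_le]) (auto simp: less_imp_le o_def)
      also have "\<dots> \<le> 1 * (5 * A)" using sums[OF I(1)] by simp
      also have "\<dots> \<le> (real (card P) + 1) * (5 * A)" using A0 by (intro mult_right_mono) auto
      finally show "(\<Sum>p\<in>T. h (2 * snd p)) \<le> (real (card P) + 1) * (5 * A)" .
    qed (use True r0 in auto)
  next
    case False
    \<comment> \<open>The single large ball pays for every ball of the rescaled net.\<close>
    then obtain n where n: "\<epsilon> * R < r n" by (auto simp: not_le)
    have "h (2 * (\<epsilon> * R)) \<le> h (2 * r n)" using n \<epsilon> R by (intro hm) auto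
    also have "\<dots> \<le> 5 * A" using sums[of "{n}"] by simp
    finally have hR: "h (2 * (\<epsilon> * R)) \<le> 5 * A" .
    show ?thesis
    proof (rule fine_coverI[of _ "(\<lambda>p. (x0 + of_real R * p, \<epsilon> * R)) ` P"])
      show "E \<subseteq> (\<Union>p\<in>(\<lambda>p. (x0 + of_real R * p, \<epsilon> * R)) ` P. ball (fst p) (snd p))"
      proof
        fix z assume "z \<in> E"
        then have "cmod ((z - x0) / of_real R) \<le> 1"
          using E R by (auto simp: norm_divide dist_norm norm_minus_commute field_simps)
        then have "(z - x0) / of_real R \<in> cball 0 1" by simp
        then obtain p where p: "p \<in> P" "cmod (p - (z - x0) / of_real R) < \<epsilon>" using P(2) by (auto simp: dist_norm)
        have "x0 + of_real R * p - z = of_real R * (p - (z - x0) / of_real R)" using R by (simp add: field_simps)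
        then have "cmod (x0 + of_real R * p - z) < \<epsilon> * R" using p(2) R by (simp add: norm_mult mult.commute)
        then show "z \<in> (\<Union>p\<in>(\<lambda>p. (x0 + of_real R * p, \<epsilon> * R)) ` P. ball (fst p) (snd p))"
          using p(1) by (auto simp: dist_norm)
      qed
      fix T assume T: "T \<subseteq> (\<lambda>p. (x0 + of_real R * p, \<epsilon> * R)) ` P" "finite T"
      have "(\<Sum>p\<in>T. h (2 * snd p)) \<le> (\<Sum>p\<in>T. 5 * A)"
        by (rule sum_mono) (use T hR in auto)
      also have "\<dots> = real (card T) * (5 * A)" by simp
      also have "\<dots> \<le> (real (card P) + 1) * (5 * A)"
        using card_mono[OF _ T(1)] card_image_le[OF P(1), of "\<lambda>p. (x0 + of_real R * p, \<epsilon> * R)"] A0 P(1)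
        by (intro mult_right_mono) auto
      finally show "(\<Sum>p\<in>T. h (2 * snd p)) \<le> (real (card P) + 1) * (5 * A)" .
    qed (use \<epsilon> R in auto)
  qed
qed

section \<open>Removing the poles of the Cauchy kernel\<close>

text \<open>Divide by \<open>z - x\<close> one factor at a time: \<open>\<phi> z / (z - x)\<close>
  is the difference quotient, which extends holomorphically, plus the simple pole
  \<open>\<phi> x / (z - x)\<close>. Old poles gain one order, so index \<open>i\<close> belongs to
  order \<open>n - i\<close> at every stage.\<close>

lemma polar_part:
  assumes f: "f holomorphic_on V" and V: "open V"
  shows "\<exists>\<phi> a. \<phi> holomorphic_on V \<and>
     (\<forall>z. z \<noteq> x \<longrightarrow> f z / (z - x) ^ n = \<phi> z + (\<Sum>i<n. a i / (z - x) ^ (n - i)))"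
proof (induction n)
  case 0
  show ?case using f by (intro exI[of _ f]) auto
next
  case (Suc n)
  then obtain \<phi> a where IH: "\<phi> holomorphic_on V"
    "\<And>z. z \<noteq> x \<Longrightarrow> f z / (z - x) ^ n = \<phi> z + (\<Sum>i<n. a i / (z - x) ^ (n - i))" by blast
  define \<psi> where "\<psi> z = (if z = x then deriv \<phi> x else (\<phi> z - \<phi> x) / (z - x))" for z
  have "\<psi> holomorphic_on V" unfolding \<psi>_def using pole_lemma_open[OF IH(1) V] by simp
  moreover have "f z / (z - x) ^ Suc n = \<psi> z + (\<Sum>i<Suc n. (a(n := \<phi> x)) i / (z - x) ^ (Suc n - i))" if "z \<noteq> x" for z
  proof -
    have "f z / (z - x) ^ Suc n = (f z / (z - x) ^ n) / (z - x)" by simp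
    also have "\<dots> = \<phi> z / (z - x) + (\<Sum>i<n. a i / (z - x) ^ (n - i) / (z - x))"
      unfolding IH(2)[OF that] by (simp add: add_divide_distrib sum_divide_distrib)
    also have "(\<Sum>i<n. a i / (z - x) ^ (n - i) / (z - x)) = (\<Sum>i<n. (a(n := \<phi> x)) i / (z - x) ^ (Suc n - i))"
      by (intro sum.cong) (auto simp: Suc_diff_le)
    also have "\<phi> z / (z - x) = \<psi> z + \<phi> x / (z - x)" using that by (simp add: \<psi>_def diff_divide_distrib)
    finally show ?thesis by simp
  qed
  ultimately show ?case by blast
qed

text \<open>All terms but the simple pole, which has index \<open>t\<close>, have a primitive away
  from \<open>x\<close>.\<close>

lemma has_contour_integral_polar:
  assumes "valid_path \<gamma>" "pathfinish \<gamma> = pathstart \<gamma>" "x \<notin> path_image \<gamma>"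
  shows "((\<lambda>z. \<Sum>i<Suc t. a i / (z - x) ^ (Suc t - i)) has_contour_integral (2 * pi * \<i> * winding_number \<gamma> x * a t)) \<gamma>"
proof -
  have 0: "((\<lambda>z. a i / (z - x) ^ (Suc t - i)) has_contour_integral 0) \<gamma>" if "i < t" for i
  proof -
    obtain k where k: "Suc t - i = Suc (Suc k)" using \<open>i < t\<close> by (metis Suc_diff_Suc Suc_diff_le less_imp_le_nat)
    have d: "((\<lambda>z. inverse (z - x) ^ Suc k / - of_nat (Suc k)) has_field_derivative 1 / (z - x) ^ Suc (Suc k)) (at z within -{x})"
      if "z \<in> -{x}" for z
    proof -
      have "z - x \<noteq> 0" using that by auto
      then have "((\<lambda>z. inverse (z - x)) has_field_derivative - (inverse (z - x) * inverse (z - x))) (at z within -{x})"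
        by (auto intro!: derivative_eq_intros simp: field_simps)
      from DERIV_cdivide[OF DERIV_power[OF this, of "Suc k"], of "- of_nat (Suc k)"] show ?thesis
        by (rule DERIV_cong) (simp add: inverse_eq_divide power_one_over del: of_nat_Suc)
    qed
    have "((\<lambda>z. 1 / (z - x) ^ Suc (Suc k)) has_contour_integral 0) \<gamma>"
      by (rule Cauchy_theorem_primitive[OF d]) (use assms in auto)
    from has_contour_integral_lmul[OF this, of "a i"] show ?thesis unfolding k by simp
  qed
  have "((\<lambda>z. \<Sum>i<t. a i / (z - x) ^ (Suc t - i)) has_contour_integral (\<Sum>i<t. 0)) \<gamma>"
    by (rule has_contour_integral_sum) (use 0 in auto)
  moreover have "((\<lambda>z. a t * (1 / (z - x))) has_contour_integral (a t * (2 * pi * \<i> * winding_number \<gamma> x))) \<gamma>"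
    by (intro has_contour_integral_lmul has_contour_integral_winding_number assms)
  ultimately have "((\<lambda>z. (\<Sum>i<t. a i / (z - x) ^ (Suc t - i)) + a t * (1 / (z - x))) has_contour_integral
     ((\<Sum>i<t. 0) + a t * (2 * pi * \<i> * winding_number \<gamma> x))) \<gamma>"
    by (rule has_contour_integral_add)
  then show ?thesis by (simp add: mult_ac)
qed

text \<open>\<open>\<phi>\<close> is the Cauchy kernel integrand of order \<open>t\<close> with its
  polar part \<open>R\<close> at \<open>x\<close> removed. Integrating over a small circle in
  \<open>V\<close>, where \<open>\<phi>\<close> contributes 0, and comparing with the Cauchy formula
  identifies the residue of \<open>R\<close>.\<close>

lemma taylor_kernel:
  assumes f: "f holomorphic_on V" and V: "open V" "x \<in> V" and cont: "continuous_on UNIV f"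
  obtains \<phi> R where "\<phi> holomorphic_on V" "continuous_on UNIV \<phi>" "R holomorphic_on -{x}"
    "\<And>z. z \<noteq> x \<Longrightarrow> \<phi> z = f z / (z - x) ^ Suc t - R z"
    "\<And>\<gamma>. valid_path \<gamma> \<Longrightarrow> pathfinish \<gamma> = pathstart \<gamma> \<Longrightarrow> x \<notin> path_image \<gamma> \<Longrightarrow>
      (R has_contour_integral (2 * pi * \<i> * winding_number \<gamma> x * ((deriv ^^ t) f x / fact t))) \<gamma>"
proof -
  obtain \<phi> a where \<phi>: "\<phi> holomorphic_on V"
    "\<And>z. z \<noteq> x \<Longrightarrow> f z / (z - x) ^ Suc t = \<phi> z + (\<Sum>i<Suc t. a i / (z - x) ^ (Suc t - i))"
    using polar_part[OF f V(1), of x "Suc t"] by blast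
  define R where "R z = (\<Sum>i<Suc t. a i / (z - x) ^ (Suc t - i))" for z
  have \<phi>R: "\<phi> z = f z / (z - x) ^ Suc t - R z" if "z \<noteq> x" for z
    using \<phi>(2)[OF that] by (simp only: R_def[symmetric]) (simp add: algebra_simps)
  have R: "R holomorphic_on -{x}" unfolding R_def by (intro holomorphic_intros) auto
  obtain r where r: "0 < r" "cball x r \<subseteq> V" using V open_contains_cball by blast
  then have rV: "ball x r \<subseteq> V" using ball_subset_cball by blast
  have Rint: "(R has_contour_integral (2 * pi * \<i> * winding_number \<gamma> x * a t)) \<gamma>"
    if "valid_path \<gamma>" "pathfinish \<gamma> = pathstart \<gamma>" "x \<notin> path_image \<gamma>" for \<gamma>
    unfolding R_def by (rule has_contour_integral_polar[OF that])
  have at: "a t = (deriv ^^ t) f x / fact t"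
  proof -
    have ni: "x \<notin> path_image (circlepath x r)" using r by simp
    have "(\<phi> has_contour_integral 0) (circlepath x r)"
      by (rule Cauchy_theorem_convex_simple[of _ "cball x r"])
        (use r \<phi>(1) in \<open>auto intro: holomorphic_on_subset\<close>)
    moreover have "(R has_contour_integral (2 * pi * \<i> * a t)) (circlepath x r)"
      using Rint[of "circlepath x r"] ni r by (simp add: winding_number_circlepath_centre)
    ultimately have "((\<lambda>z. \<phi> z + R z) has_contour_integral (0 + 2 * pi * \<i> * a t)) (circlepath x r)"
      by (rule has_contour_integral_add)
    then have "((\<lambda>z. f z / (z - x) ^ Suc t) has_contour_integral (0 + 2 * pi * \<i> * a t)) (circlepath x r)"
    proof (rule has_contour_integral_eq)
      fix z assume "z \<in> path_image (circlepath x r)"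
      then have "z \<noteq> x" using ni by blast
      then show "\<phi> z + R z = f z / (z - x) ^ Suc t" using \<phi>R[of z] by simp
    qed
    moreover have "((\<lambda>z. f z / (z - x) ^ Suc t) has_contour_integral (2 * pi * \<i> / fact t * (deriv ^^ t) f x)) (circlepath x r)"
      by (rule Cauchy_has_contour_integral_higher_derivative_circlepath)
        (use r rV f cont in \<open>auto intro: holomorphic_on_subset continuous_on_subset\<close>)
    ultimately have "0 + 2 * pi * \<i> * a t = 2 * pi * \<i> / fact t * (deriv ^^ t) f x"
      by (rule has_contour_integral_unique)
    then show ?thesis by (simp add: field_simps)
  qed
  \<comment> \<open>Outside \<open>V\<close> the function \<open>f\<close> is merely continuous, so
    continuity of \<open>\<phi>\<close> is glued from the formula off \<open>x\<close> and
    holomorphy on \<open>V\<close>.\<close>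
  have "continuous_on (-{x} \<union> V) \<phi>"
  proof (rule continuous_on_open_Un)
    have "continuous_on (-{x}) (\<lambda>z. f z / (z - x) ^ Suc t - R z)"
      using holomorphic_on_imp_continuous_on[OF R] continuous_on_subset[OF cont]
      by (intro continuous_intros) auto
    then show "continuous_on (-{x}) \<phi>" using \<phi>R by (subst continuous_on_cong[OF refl, of _ \<phi>]) auto
  qed (use V \<phi>(1) in \<open>auto intro: holomorphic_on_imp_continuous_on\<close>)
  moreover have "-{x} \<union> V = UNIV" using V by auto
  ultimately have \<phi>cont: "continuous_on UNIV \<phi>" by simp
  show ?thesis
    by (rule that[OF \<phi>(1) \<phi>cont R \<phi>R Rint[unfolded at]])
qed

text \<open>For \<open>r \<le> d\<close> the two terms are estimated separately and
  \<open>(d / r) powr lam \<ge> 1\<close>. For \<open>r > d\<close> the difference gains a factor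
  \<open>d / r\<close>, which is at most \<open>(d / r) powr lam\<close> because
  \<open>lam < 1\<close>. The two summands of the constant belong to these two cases.\<close>

lemma kernel_diff_bound:
  fixes x y z x0 :: complex
  assumes c: "0 < c" and r: "0 < r" "c * r \<le> cmod (z - x)" "c * r \<le> cmod (z - y)"
    and d: "0 < d" "cmod (x - x0) \<le> d" "cmod (y - x0) \<le> d" and lam: "0 < lam" "lam < 1"
  shows "cmod (1 / (z - x) ^ Suc t - 1 / (z - y) ^ Suc t)
    \<le> (2 / c ^ Suc t + 2 * Suc t / c ^ Suc (Suc t)) * ((d / r) powr lam / r ^ Suc t)"
proof -
  define m where "m = Suc t"
  define u v where "u = 1 / (z - x)" and "v = 1 / (z - y)"
  define N where "N = 1 / (c * r)"
  have N: "0 < N" using c r by (simp add: N_def)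
  have cr: "0 < c * r" using c r by simp
  then have nz: "0 < cmod (z - x)" "0 < cmod (z - y)" using r by linarith+
  have u: "cmod u \<le> N" and v: "cmod v \<le> N"
    using r(2,3) cr nz by (auto simp: u_def v_def N_def norm_divide intro!: divide_left_mono)
  have eq: "1 / (z - x) ^ m - 1 / (z - y) ^ m = u ^ m - v ^ m" by (simp add: u_def v_def power_one_over)
  define X where "X = (d / r) powr lam / r ^ m"
  have X: "0 \<le> X" using r by (simp add: X_def)
  have Nm: "N ^ m = 1 / (c ^ m * r ^ m)" by (simp add: N_def power_one_over power_mult_distrib)
  have "cmod (u ^ m - v ^ m) \<le> (2 / c ^ m + 2 * m / c ^ Suc m) * X"
  proof (cases "r \<le> d")
    case True
    have "cmod (u ^ m - v ^ m) \<le> cmod u ^ m + cmod v ^ m"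
      using norm_triangle_ineq4[of "u ^ m" "v ^ m"] by (simp add: norm_power)
    also have "\<dots> \<le> N ^ m + N ^ m" by (intro add_mono power_mono u v) auto
    also have "\<dots> = 2 / c ^ m * (1 / r ^ m)" by (simp add: Nm)
    also have "\<dots> \<le> 2 / c ^ m * X"
    proof (rule mult_left_mono)
      have "1 \<le> (d / r) powr lam" using True r lam by (intro ge_one_powr_ge_zero) auto
      then show "1 / r ^ m \<le> X" using r by (auto simp: X_def intro!: divide_right_mono)
    qed (use c in auto)
    also have "\<dots> \<le> (2 / c ^ m + 2 * m / c ^ Suc m) * X" using X c by (intro mult_right_mono) auto
    finally show ?thesis .
  next
    case False
    \<comment> \<open>\<open>norm_power_diff\<close> is for points of the unit disc, hence the
      normalisation by \<open>N\<close>.\<close>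
    have "cmod ((u / of_real N) ^ m - (v / of_real N) ^ m) \<le> m * cmod (u / of_real N - v / of_real N)"
      using u v N by (intro norm_power_diff) (auto simp: norm_divide)
    also have "u / of_real N - v / of_real N = (u - v) / of_real N" by (simp add: diff_divide_distrib)
    also have "(u / of_real N) ^ m - (v / of_real N) ^ m = (u ^ m - v ^ m) / of_real (N ^ m)"
      by (simp add: power_divide diff_divide_distrib)
    finally have "cmod (u ^ m - v ^ m) / N ^ m \<le> m * (cmod (u - v) / N)"
      using N by (simp add: norm_divide norm_power)
    then have 1: "cmod (u ^ m - v ^ m) \<le> N ^ m * (m * (cmod (u - v) / N))"
      using N by (simp add: field_simps)
    have "u - v = (x - y) * u * v" using nz by (auto simp: u_def v_def field_simps)
    then have "cmod (u - v) = cmod (x - y) * (cmod u * cmod v)" by (simp add: norm_mult)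
    also have "\<dots> \<le> (2 * d) * (N * N)"
    proof (intro mult_mono u v)
      show "cmod (x - y) \<le> 2 * d" using d norm_triangle_ineq4[of "x - x0" "y - x0"] by simp
    qed (use N d in auto)
    finally have "cmod (u - v) / N \<le> 2 * d * N" using N by (simp add: field_simps)
    then have "N ^ m * (m * (cmod (u - v) / N)) \<le> N ^ m * (m * (2 * d * N))"
      using N by (intro mult_left_mono) auto
    also have "\<dots> = 2 * m / c ^ Suc m * ((d / r) / r ^ m)"
      using c r by (simp add: Nm N_def field_simps)
    also have "\<dots> \<le> 2 * m / c ^ Suc m * X"
    proof (rule mult_left_mono)
      have "(d / r) powr 1 \<le> (d / r) powr lam" using False d r lam by (intro powr_mono') auto
      then have "d / r \<le> (d / r) powr lam" using d r by simp
      then show "d / r / r ^ m \<le> X" unfolding X_def using r by (intro divide_right_mono) auto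
    qed (use c in auto)
    also have "\<dots> \<le> (2 / c ^ m + 2 * m / c ^ Suc m) * X" using X c by (intro mult_right_mono) auto
    finally show ?thesis using 1 by linarith
  qed
  then show ?thesis unfolding eq[unfolded m_def] X_def m_def .
qed

section \<open>Covers of the annuli\<close>

lemma hcontent_mono: "E \<subseteq> E' \<Longrightarrow> hcontent h E \<le> hcontent h E'"
  unfolding hcontent_def by (intro INF_superset_mono) auto

text \<open>Moves the summability hypothesis to finite sums of reals; positive weights force every
  term to be finite.\<close>

lemma ennreal_weighted_suminf:
  fixes c :: "nat \<Rightarrow> real" and e :: "nat \<Rightarrow> ennreal"
  assumes c: "\<And>n. 0 < c n" and fin: "(\<Sum>n. ennreal (c n) * e n) < \<infinity>"
  shows "e n < \<infinity>"
    and "finite I \<Longrightarrow> (\<Sum>n\<in>I. c n * enn2real (e n)) \<le> enn2real (\<Sum>n. ennreal (c n) * e n)"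
proof -
  have e: "e n < \<infinity>" for n
  proof -
    have "ennreal (c n) * e n \<le> (\<Sum>n. ennreal (c n) * e n)"
      using sum_le_suminf[of "\<lambda>n. ennreal (c n) * e n" "{n}"] by simp
    then have "ennreal (c n) * e n < top" using fin by (simp add: le_less_trans)
    then show ?thesis using c[of n] by (auto simp: ennreal_mult_less_top)
  qed
  then show "e n < \<infinity>" .
  assume I: "finite I"
  have "ennreal (\<Sum>n\<in>I. c n * enn2real (e n)) = (\<Sum>n\<in>I. ennreal (c n * enn2real (e n)))"
    using c by (simp add: less_imp_le)
  also have "\<dots> = (\<Sum>n\<in>I. ennreal (c n) * e n)"
    using c e by (intro sum.cong) (auto simp: ennreal_mult less_imp_le)
  also have "\<dots> \<le> (\<Sum>n. ennreal (c n) * e n)" using I by (intro sum_le_suminf) auto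
  finally have "enn2real (ennreal (\<Sum>n\<in>I. c n * enn2real (e n))) \<le> enn2real (\<Sum>n. ennreal (c n) * e n)"
    using fin by (intro enn2real_mono) auto
  then show "(\<Sum>n\<in>I. c n * enn2real (e n)) \<le> enn2real (\<Sum>n. ennreal (c n) * e n)"
    using c by (subst (asm) enn2real_ennreal) (auto intro!: sum_nonneg simp: less_imp_le)
qed

text \<open>The annulus together with its inner circle: unlike the open annuli, the shells leave no
  gaps around \<open>x0\<close>.\<close>

definition shell :: "complex \<Rightarrow> nat \<Rightarrow> complex set" where
  "shell x0 n = {z. 2 powr (- real n - 1) \<le> cmod (z - x0) \<and> cmod (z - x0) < 2 powr (- real n)}"

lemma obtain_shell:
  assumes "z \<noteq> x0" "cmod (z - x0) < 1/2"
  obtains k where "z \<in> shell x0 (Suc k)"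
proof -
  define r where "r = cmod (z - x0)"
  have r: "0 < r" "r < 1/2" using assms by (auto simp: r_def)
  obtain n where "(1/2) ^ n < r" using real_arch_pow_inv[of r "1/2"] r by auto
  then have ex: "\<exists>n. (1/2) ^ n \<le> r" by (auto intro: less_imp_le)
  define m where "m = (LEAST n. (1/2) ^ n \<le> r)"
  have m: "(1/2) ^ m \<le> r" unfolding m_def using ex by (rule LeastI_ex)
  have low: "\<not> (1/2) ^ n \<le> r" if "n < m" for n
    using not_less_Least that unfolding m_def by blast
  \<comment> \<open>As \<open>r < 1/2\<close>, the least exponent is at least 2, so the shell index
    \<open>m - 1\<close> is positive, as in the series over the annuli.\<close>
  have "m \<noteq> 0" "m \<noteq> 1" using m r by (auto intro: ccontr)
  then obtain k where k: "m = Suc (Suc k)" by (metis One_nat_def not0_implies_Suc)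
  have p: "2 powr (- real n) = (1/2) ^ n" for n
    by (simp add: powr_minus powr_realpow power_one_over inverse_eq_divide)
  have "2 powr (- real (Suc k) - 1) = (1/2) ^ m"
    using p[of m] by (simp add: k algebra_simps)
  moreover have "r < 2 powr (- real (Suc k))" unfolding p using low[of "Suc k"] k by (simp only: not_le lessI)
  ultimately have "z \<in> shell x0 (Suc k)" using m by (simp add: shell_def r_def)
  then show ?thesis by (rule that)
qed

section \<open>Integrals over small squares and covers of all shells\<close>

context lip_fun
begin

lemma continuous_f: "continuous_on A f"
proof -
  have "\<exists>\<delta>>0. \<forall>z. dist z w < \<delta> \<longrightarrow> dist (f z) (f w) < e" if e: "0 < e" for w e
  proof (intro exI[of _ "(e / M) powr (1 / \<alpha>)"] conjI allI impI)
    fix z assume "dist z w < (e / M) powr (1 / \<alpha>)"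
    then have "cmod (z - w) powr \<alpha> < ((e / M) powr (1 / \<alpha>)) powr \<alpha>"
      using \<alpha> by (intro powr_less_mono2) (auto simp: dist_norm)
    also have "\<dots> = e / M" using \<alpha> e M by (simp add: powr_powr)
    finally have "M * cmod (z - w) powr \<alpha> < e" using M by (simp add: field_simps)
    then show "dist (f z) (f w) < e" using f_diff[of z w] by (simp add: dist_norm)
  qed (use e M in auto)
  then have "continuous_on UNIV f" unfolding continuous_on_iff by blast
  then show ?thesis by (rule continuous_on_subset) auto
qed

text \<open>On the square \<open>f a * g - R\<close> is holomorphic and integrates to 0, so
  \<open>f\<close> may be replaced by \<open>f - f a\<close>, of size at most
  \<open>modulus f (2 * s)\<close>. Perimeter times supremum is then rewritten in terms of the
  gauge.\<close>

lemma norm_sqint_kernel_le: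
  assumes F: "continuous_on (csq a s) F" and s: "0 \<le> s" "s \<le> r"
    and R: "R holomorphic_on csq a s" and g: "g holomorphic_on csq a s"
    and eq: "\<And>z. z \<in> csq a s \<Longrightarrow> F z = f z * g z - R z"
    and B: "\<And>z. z \<in> csq a s \<Longrightarrow> cmod (g z) \<le> B"
  shows "cmod (sqint F a s) \<le> 2 * B * M * lip_gauge M f (2 * r)"
proof -
  let ?\<gamma> = "rectpath a (a + Complex s s)"
  let ?G = "\<lambda>z. (f z - f a) * g z" and ?D = "\<lambda>z. f a * g z - R z"
  have pi: "path_image ?\<gamma> \<subseteq> csq a s" by (rule path_image_sq[OF s(1)])
  have a: "a \<in> csq a s" using s by (auto simp: in_csq_iff)
  have B0: "0 \<le> B" using B[OF a] norm_ge_zero order_trans by blast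
  have cG: "continuous_on (csq a s) ?G"
    by (intro continuous_intros continuous_f holomorphic_on_imp_continuous_on g)
  have hD: "?D holomorphic_on csq a s" by (intro holomorphic_intros g R)
  have "sqint F a s = sqint (\<lambda>z. ?G z + ?D z) a s"
    unfolding sqint_def by (rule contour_integral_eq) (use pi eq in \<open>auto simp: algebra_simps\<close>)
  also have "\<dots> = sqint ?G a s + sqint ?D a s"
    unfolding sqint_def
    by (intro contour_integral_add sqint_sides(2) continuous_on_subset[OF _ pi] cG holomorphic_on_imp_continuous_on hD)
  also have "sqint ?D a s = 0" by (rule sqint_holomorphic_eq_0[OF hD s(1)])
  finally have "cmod (sqint F a s) = cmod (sqint ?G a s)" by simp
  also have "\<dots> \<le> 4 * s * (modulus f (2 * s) * B)"
  proof (rule norm_sqint_le)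
    show "0 \<le> modulus f (2 * s) * B" using modulus_nonneg[OF f_le] s B0 by simp
    fix z assume "z \<in> path_image ?\<gamma>"
    then have z: "z \<in> csq a s" using pi by auto
    have "cmod (f z - f a) \<le> modulus f (2 * s)"
      by (rule modulus_upper[OF f_le]) (rule dist_csq_le[OF z a])
    then show "cmod (?G z) \<le> modulus f (2 * s) * B"
      unfolding norm_mult using B[OF z] modulus_nonneg[OF f_le, of "2 * s"] s by (intro mult_mono) auto
  qed (use s continuous_on_subset[OF cG pi] in auto)
  also have "\<dots> \<le> 4 * r * (modulus f (2 * r) * B)"
    using s B0 modulus_mono[of f M "2 * s" "2 * r"] modulus_nonneg[of f M "2 * r"] modulus_nonneg[of f M "2 * s"] f_le
    by (intro mult_mono) auto
  also have "\<dots> = 2 * B * M * lip_gauge M f (2 * r)" using M by (simp add: lip_gauge_def field_simps)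
  finally show ?thesis .
qed

lemma gauge_small:
  assumes "0 \<le> r" "r \<le> 1" shows "lip_gauge M f r \<le> r"
proof -
  have "r powr (1 + \<alpha>) \<le> r powr 1" using assms \<alpha> by (intro powr_mono') auto
  then show ?thesis using gauge_le_powr[of r] assms by simp
qed

text \<open>Each shell is an open annulus, whose cover is governed by the lower content, and its
  inner circle, whose cover is arbitrarily cheap. The net \<open>P\<close> is the same for all
  shells, so the loss is a uniform factor.\<close>

lemma fine_cover_shells:
  fixes P :: "complex set"
  assumes fin: "(\<Sum>n. ennreal (2 powr (\<kappa> * real (Suc n))) * lower_content \<alpha> (annulus x0 (Suc n) - U)) < \<infinity>"
    and \<epsilon>: "0 < \<epsilon>" and P: "finite P" "cball 0 1 \<subseteq> (\<Union>p\<in>P. ball p \<epsilon>)"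
  defines "S \<equiv> enn2real (\<Sum>n. ennreal (2 powr (\<kappa> * real (Suc n))) * lower_content \<alpha> (annulus x0 (Suc n) - U))"
  shows "\<exists>b. (\<forall>k. fine_cover (lip_gauge M f) (\<epsilon> * 2 powr (- real (Suc k))) ((Q - U) \<inter> shell x0 (Suc k)) (b k)) \<and>
     (\<forall>I. finite I \<longrightarrow> (\<Sum>k\<in>I. 2 powr (\<kappa> * real (Suc k)) * b k) \<le> (real (card P) + 1) * (5 * (S + 1)) + 1)"
proof -
  define c where "c k = 2 powr (\<kappa> * real (Suc k))" for k :: nat
  have c: "0 < c k" for k by (simp add: c_def)
  define e where "e k = lower_content \<alpha> (annulus x0 (Suc k) - U)" for k
  have fin': "(\<Sum>n. ennreal (c n) * e n) < \<infinity>" using fin by (simp add: c_def e_def)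
  note E = ennreal_weighted_suminf[OF c fin']
  have S: "S = enn2real (\<Sum>n. ennreal (c n) * e n)" by (simp add: S_def c_def e_def)
  \<comment> \<open>A positive slack is needed for a strict content bound and for the circle; its
    weighted sum over all shells is at most 1.\<close>
  define \<delta> where "\<delta> k = (1/2) ^ Suc k / c k" for k
  have \<delta>: "0 < \<delta> k" for k using c[of k] by (simp add: \<delta>_def)
  define b where "b k = (real (card P) + 1) * (5 * (enn2real (e k) + \<delta> k)) + \<delta> k" for k
  have "fine_cover (lip_gauge M f) (\<epsilon> * 2 powr (- real (Suc k))) ((Q - U) \<inter> shell x0 (Suc k)) (b k)" for k
  proof -
    let ?q = "2 powr (- real (Suc k))"
    let ?E1 = "(Q - U) \<inter> annulus x0 (Suc k)"
    have split: "(Q - U) \<inter> shell x0 (Suc k) = ?E1 \<union> ((Q - U) \<inter> {z. cmod (z - x0) = 2 powr (- real (Suc k) - 1) \<and> cmod (z - x0) < ?q})"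
      by (auto simp: shell_def annulus_def)
    have "hcontent (lip_gauge M f) ?E1 \<le> hcontent (lip_gauge M f) (annulus x0 (Suc k) - U)"
      by (rule hcontent_mono) auto
    also have "\<dots> \<le> e k" unfolding e_def by (rule hcontent_gauge_le)
    also have "e k = ennreal (enn2real (e k))" using E(1)[of k] by simp
    also have "\<dots> < ennreal (enn2real (e k) + \<delta> k)" using \<delta>[of k] by (intro ennreal_lessI) (auto intro: add_nonneg_pos)
    finally have lt: "hcontent (lip_gauge M f) ?E1 < ennreal (enn2real (e k) + \<delta> k)" .
    have "fine_cover (lip_gauge M f) (\<epsilon> * ?q) ?E1 ((real (card P) + 1) * (5 * (enn2real (e k) + \<delta> k)))"
    proof (rule fine_cover_hcontent[OF _ _ _ _ _ \<epsilon> P lt])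
      show "measure_function (lip_gauge M f)"
        using gauge_nonneg gauge_mono by (auto simp: measure_function_def mono_on_def)
      show "?E1 \<subseteq> cball x0 ?q" by (auto simp: annulus_def dist_norm norm_minus_commute)
    qed (use gauge_double gauge_small in auto)
    moreover have "fine_cover (lip_gauge M f) (\<epsilon> * ?q) ((Q - U) \<inter> {z. cmod (z - x0) = 2 powr (- real (Suc k) - 1) \<and> cmod (z - x0) < ?q}) (\<delta> k)"
    proof (rule fine_cover_sphere[OF \<alpha>(1)])
      show "(Q - U) \<inter> {z. cmod (z - x0) = 2 powr (- real (Suc k) - 1) \<and> cmod (z - x0) < ?q} \<subseteq> sphere x0 (2 powr (- real (Suc k) - 1))"
        by (auto simp: dist_norm norm_minus_commute)
    qed (use gauge_le_powr \<epsilon> \<delta> in auto)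
    ultimately show ?thesis
      unfolding split b_def by (rule fine_cover_Un)
  qed
  moreover have "(\<Sum>k\<in>I. c k * b k) \<le> (real (card P) + 1) * (5 * (S + 1)) + 1" if I: "finite I" for I
  proof -
    have "c k * b k = (real (card P) + 1) * (5 * (c k * enn2real (e k) + (1/2) ^ Suc k)) + (1/2) ^ Suc k" for k
      using c[of k] by (simp add: b_def \<delta>_def field_simps)
    then have "(\<Sum>k\<in>I. c k * b k) = (\<Sum>k\<in>I. (real (card P) + 1) * (5 * (c k * enn2real (e k) + (1/2) ^ Suc k)) + (1/2) ^ Suc k)"
      by (simp only:)
    also have "\<dots> = (real (card P) + 1) * (5 * ((\<Sum>k\<in>I. c k * enn2real (e k)) + (\<Sum>k\<in>I. (1/2) ^ Suc k))) + (\<Sum>k\<in>I. (1/2) ^ Suc k)"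
      by (simp only: sum.distrib sum_distrib_left[symmetric])
    also have "\<dots> \<le> (real (card P) + 1) * (5 * (S + 1)) + 1"
    proof -
      have "(\<Sum>n\<in>I. (1/2::real) ^ Suc n) \<le> (\<Sum>n. (1/2) ^ Suc n)"
        using power_half_series I by (intro sum_le_suminf) (auto simp: sums_iff)
      also have "\<dots> = 1" using power_half_series by (simp add: sums_iff)
      finally have 2: "(\<Sum>n\<in>I. (1/2::real) ^ Suc n) \<le> 1" .
      show ?thesis using E(2)[OF I] 2 unfolding S by (intro add_mono mult_left_mono) auto
    qed
    finally show ?thesis .
  qed
  ultimately show ?thesis unfolding c_def by (intro exI[of _ b]) blast
qed

end

section \<open>Oscillation of the derivative along the ray\<close>

text \<open>The sector survives only through \<open>cone\<close>: complement points near
  \<open>x0\<close> keep a distance from \<open>x\<close> in \<open>J\<close> comparable to that of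
  \<open>x\<close> from \<open>x0\<close>.\<close>

locale cone_point =
  fixes \<alpha> lam \<rho> L K :: real and U J :: "complex set" and x0 :: complex and t :: nat
  assumes \<alpha>: "0 < \<alpha>" "\<alpha> < 1" and lam: "0 < lam" "lam < 1"
    and U: "open U" and \<rho>: "0 < \<rho>" and K: "0 < K"
    and J: "J - {x0} \<subseteq> U" "\<And>x. x \<in> J \<Longrightarrow> cmod (x - x0) \<le> L" "L < \<rho>"
    and cone: "\<And>x z. x \<in> J \<Longrightarrow> z \<notin> U \<Longrightarrow> cmod (z - x0) < \<rho> \<Longrightarrow> cmod (x - x0) \<le> K * cmod (z - x)"
    and content: "(\<Sum>n. ennreal (2 powr ((real t + 1 + lam) * real (Suc n)))
              * lower_content \<alpha> (annulus x0 (Suc n) - U)) < \<infinity>"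
begin

text \<open>Half the side of \<open>Q\<close>, which lies within \<open>2 * \<sigma>\<close> of
  \<open>x0\<close>: the bound \<open>\<rho>\<close> makes \<open>cone\<close> available on
  \<open>Q\<close>, and 1/2 makes the shells of positive index cover it up to
  \<open>x0\<close>.\<close>

definition "\<sigma> = min \<rho> (1/2) / 2"
definition "Q = csq (x0 - Complex \<sigma> \<sigma>) (2 * \<sigma>)"
text \<open>Radius of covering balls relative to their shell. The bound \<open>\<sigma>\<close>
  keeps them smaller than \<open>Q\<close>; the factor 16 puts stopped squares within the range of
  \<open>near_complement\<close>.\<close>

definition "\<epsilon> = min \<sigma> (1 / (16 * (1 + K)))"
definition "cc = 1 / (4 * (1 + K))"
definition "Ck = 2 / cc ^ Suc t + 2 * Suc t / cc ^ Suc (Suc t)"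
text \<open>Both the decay exponent of the kernel difference and the exponent of the weights in the
  series.\<close>

definition "\<kappa> = real t + 1 + lam"

lemma \<sigma>: "0 < \<sigma>" "2 * \<sigma> \<le> \<rho>" "2 * \<sigma> \<le> 1/2" using \<rho> by (auto simp: \<sigma>_def)
lemma \<epsilon>: "0 < \<epsilon>" "\<epsilon> \<le> \<sigma>" "16 * (1 + K) * \<epsilon> \<le> 1"
proof -
  show "0 < \<epsilon>" "\<epsilon> \<le> \<sigma>" using \<sigma> K by (auto simp: \<epsilon>_def)
  have "\<epsilon> \<le> 1 / (16 * (1 + K))" by (simp add: \<epsilon>_def)
  then show "16 * (1 + K) * \<epsilon> \<le> 1" using K by (simp add: field_simps)
qed
lemma cc: "0 < cc" "cc \<le> 1/4" using K by (auto simp: cc_def field_simps)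
lemma Ck: "0 < Ck" using cc by (auto simp: Ck_def intro!: add_pos_nonneg)

lemma in_Q_iff: "z \<in> Q \<longleftrightarrow> \<bar>Re (z - x0)\<bar> \<le> \<sigma> \<and> \<bar>Im (z - x0)\<bar> \<le> \<sigma>"
  by (auto simp: Q_def in_csq_iff)

lemma in_Q_norm: "z \<in> Q \<Longrightarrow> cmod (z - x0) < 2 * \<sigma>"
proof -
  assume z: "z \<in> Q"
  have "(cmod (z - x0))\<^sup>2 = \<bar>Re (z - x0)\<bar>\<^sup>2 + \<bar>Im (z - x0)\<bar>\<^sup>2" by (simp add: cmod_power2)
  also have "\<dots> \<le> \<sigma>\<^sup>2 + \<sigma>\<^sup>2" using z in_Q_iff by (intro add_mono power_mono) auto
  also have "\<dots> < (2 * \<sigma>)\<^sup>2" using \<sigma> by (simp add: power2_eq_square)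
  finally show ?thesis by (rule power_less_imp_less_base) (use \<sigma> in auto)
qed

lemma boundary_Q:
  assumes "z \<in> path_image (rectpath (x0 - Complex \<sigma> \<sigma>) (x0 - Complex \<sigma> \<sigma> + Complex (2 * \<sigma>) (2 * \<sigma>)))"
  shows "\<sigma> \<le> cmod (z - x0)"
proof -
  have "z \<in> cbox (x0 - Complex \<sigma> \<sigma>) (x0 - Complex \<sigma> \<sigma> + Complex (2 * \<sigma>) (2 * \<sigma>)) -
      box (x0 - Complex \<sigma> \<sigma>) (x0 - Complex \<sigma> \<sigma> + Complex (2 * \<sigma>) (2 * \<sigma>))"
    using assms \<sigma> by (subst (asm) path_image_rectpath_cbox_minus_box) auto
  then have "\<sigma> \<le> \<bar>Re (z - x0)\<bar> \<or> \<sigma> \<le> \<bar>Im (z - x0)\<bar>"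
    by (auto simp: in_cbox_complex_iff in_box_complex_iff)
  then show ?thesis using abs_Re_le_cmod[of "z - x0"] abs_Im_le_cmod[of "z - x0"] by linarith
qed

text \<open>The cone condition gives \<open>cmod (e - x0) \<le> (1 + K) * cmod (e - x)\<close>.
  Moving from \<open>e\<close> by half of \<open>cmod (e - x0) / (1 + K)\<close> costs only constant
  factors; the last claim keeps \<open>z\<close> away from \<open>x\<close>.\<close>

lemma near_complement:
  assumes e: "e \<notin> U" "cmod (e - x0) < \<rho>" and x: "x \<in> J"
    and ze: "cmod (z - e) \<le> cmod (e - x0) / (2 * (1 + K))"
  shows "cc * cmod (z - x0) \<le> cmod (z - x)" "cmod (e - x0) \<le> 2 * cmod (z - x0)"
    and "cmod (e - x0) \<le> 2 * (1 + K) * cmod (z - x)"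
proof -
  define q where "q = cmod (e - x0) / (1 + K)"
  have q: "cmod (e - x0) = (1 + K) * q" "0 \<le> q" using K by (auto simp: q_def)
  have "cmod (e - x0) \<le> cmod (e - x) + cmod (x - x0)"
    using norm_triangle_ineq[of "e - x" "x - x0"] by simp
  also have "\<dots> \<le> (1 + K) * cmod (e - x)" using cone[OF x e] by (simp add: algebra_simps)
  finally have 1: "q \<le> cmod (e - x)" using q K by simp
  have 2: "cmod (z - e) \<le> q / 2" using ze by (simp add: q_def algebra_simps)
  have "cmod (e - x) \<le> cmod (z - x) + cmod (z - e)"
    using norm_triangle_ineq4[of "z - x" "z - e"] by simp
  with 1 2 have 3: "q / 2 \<le> cmod (z - x)" by linarith
  have qe: "q \<le> cmod (e - x0)" using q K by (simp add: algebra_simps)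
  have "cmod (z - x0) \<le> cmod (z - e) + cmod (e - x0)"
    using norm_triangle_ineq[of "z - e" "e - x0"] by simp
  with 2 qe have "cmod (z - x0) \<le> 2 * ((1 + K) * q)" using q by linarith
  then have "cc * cmod (z - x0) \<le> cc * (2 * ((1 + K) * q))" using cc by (intro mult_left_mono) auto
  also have "\<dots> = q / 2" using K by (simp add: cc_def field_simps)
  finally show "cc * cmod (z - x0) \<le> cmod (z - x)" using 3 by linarith
  have "cmod (e - x0) \<le> cmod (z - x0) + cmod (z - e)"
    using norm_triangle_ineq4[of "z - x0" "z - e"] by simp
  with 2 qe show "cmod (e - x0) \<le> 2 * cmod (z - x0)" by linarith
  show "cmod (e - x0) \<le> 2 * (1 + K) * cmod (z - x)"
    using mult_left_mono[OF 3, of "2 * (1 + K)"] K q by (simp add: algebra_simps)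
qed

text \<open>The core estimate, with \<open>C\<close> independent of \<open>f\<close> and of the two
  points. The bound \<open>d \<le> \<sigma> / 2\<close> keeps both points well inside
  \<open>Q\<close>.\<close>

lemma deriv_oscillation:
  "\<exists>C>0. \<forall>M f x y d. lip_fun \<alpha> M f \<longrightarrow> f holomorphic_on U \<longrightarrow> x \<in> J - {x0} \<longrightarrow> y \<in> J - {x0} \<longrightarrow>
     cmod (x - x0) \<le> d \<longrightarrow> cmod (y - x0) \<le> d \<longrightarrow> d \<le> \<sigma> / 2 \<longrightarrow>
     cmod ((deriv ^^ t) f x - (deriv ^^ t) f y) \<le> C * M * d powr lam"
proof -
  obtain P :: "complex set" where P: "finite P" "cball 0 1 \<subseteq> (\<Union>p\<in>P. ball p \<epsilon>)"
  proof -
    have "cball (0::complex) 1 \<subseteq> (\<Union>p\<in>cball 0 1. ball p \<epsilon>)" using \<epsilon>(1) by auto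
    from compactE_image[OF compact_cball _ this] that show ?thesis by (metis open_ball)
  qed
  define S where "S = enn2real (\<Sum>n. ennreal (2 powr (\<kappa> * real (Suc n))) * lower_content \<alpha> (annulus x0 (Suc n) - U))"
  define S' where "S' = (real (card P) + 1) * (5 * (S + 1)) + 1"
  have S'0: "0 \<le> S'" by (simp add: S'_def S_def)
  \<comment> \<open>The summand 1 pays for the ball about \<open>x0\<close>, the other one for the
    shells; \<open>C2\<close> below is the perimeter of \<open>Q\<close> times the kernel bound on
    its boundary.\<close>
  define C1 where "C1 = 144 * (1 + 2 * (Ck * 4 powr \<kappa>) * S')"
  define C2 where "C2 = 4 * (2 * \<sigma>) * (Ck * \<sigma> powr (- \<kappa>))"
  define C where "C = fact t * (C1 + C2)"
  have C1: "0 < C1" using Ck S'0 by (auto simp: C1_def intro!: add_pos_nonneg)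
  have C2: "0 \<le> C2" using Ck \<sigma> by (simp add: C2_def)
  have "0 < C" using C1 C2 by (auto simp: C_def intro!: mult_pos_pos)
  moreover have "cmod ((deriv ^^ t) f x - (deriv ^^ t) f y) \<le> C * M * d powr lam"
    if "lip_fun \<alpha> M f" and f: "f holomorphic_on U" and x: "x \<in> J" "x \<noteq> x0" and y: "y \<in> J" "y \<noteq> x0"
     and xd: "cmod (x - x0) \<le> d" and yd: "cmod (y - x0) \<le> d" and d\<sigma>: "d \<le> \<sigma> / 2" for M f x y d
  proof -
    interpret lip_fun \<alpha> M f by fact
    have d: "0 < d" using x xd by (meson zero_less_norm_iff eq_iff_diff_eq_0 less_le_trans)
    have xU: "x \<in> U" and yU: "y \<in> U" using x y J by auto
    define m where "m = Suc t"
    define g where "g z = 1 / (z - x) ^ m - 1 / (z - y) ^ m" for z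
    obtain \<phi>x Rx where fx: "\<phi>x holomorphic_on U" "continuous_on UNIV \<phi>x" "Rx holomorphic_on -{x}"
      "\<And>z. z \<noteq> x \<Longrightarrow> \<phi>x z = f z / (z - x) ^ Suc t - Rx z"
      "\<And>\<gamma>. valid_path \<gamma> \<Longrightarrow> pathfinish \<gamma> = pathstart \<gamma> \<Longrightarrow> x \<notin> path_image \<gamma> \<Longrightarrow>
        (Rx has_contour_integral (2 * pi * \<i> * winding_number \<gamma> x * ((deriv ^^ t) f x / fact t))) \<gamma>"
      using taylor_kernel[OF f U xU continuous_f] by blast
    obtain \<phi>y Ry where fy: "\<phi>y holomorphic_on U" "continuous_on UNIV \<phi>y" "Ry holomorphic_on -{y}"
      "\<And>z. z \<noteq> y \<Longrightarrow> \<phi>y z = f z / (z - y) ^ Suc t - Ry z"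
      "\<And>\<gamma>. valid_path \<gamma> \<Longrightarrow> pathfinish \<gamma> = pathstart \<gamma> \<Longrightarrow> y \<notin> path_image \<gamma> \<Longrightarrow>
        (Ry has_contour_integral (2 * pi * \<i> * winding_number \<gamma> y * ((deriv ^^ t) f y / fact t))) \<gamma>"
      using taylor_kernel[OF f U yU continuous_f] by blast
    \<comment> \<open>\<open>F\<close> is \<open>f g\<close> with its poles at \<open>x\<close> and
      \<open>y\<close> removed, \<open>R\<close> the sum of what was removed; \<open>F\<close> is
      holomorphic on \<open>U\<close> and continuous everywhere.\<close>
    define F where "F z = \<phi>x z - \<phi>y z" for z
    define R where "R z = Rx z - Ry z" for z
    have Fcont: "continuous_on A F" for A
      unfolding F_def by (intro continuous_intros continuous_on_subset[OF fx(2)] continuous_on_subset[OF fy(2)]) auto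
    have Fhol: "F holomorphic_on U" unfolding F_def by (intro holomorphic_intros fx fy)
    have Feq: "F z = f z * g z - R z" if "z \<noteq> x" "z \<noteq> y" for z
      unfolding F_def R_def g_def m_def fx(4)[OF that(1)] fy(4)[OF that(2)]
      by (simp add: right_diff_distrib del: power_Suc)
    have Rhol: "R holomorphic_on A" if "x \<notin> A" "y \<notin> A" for A
      unfolding R_def using that
      by (intro holomorphic_intros holomorphic_on_subset[OF fx(3)] holomorphic_on_subset[OF fy(3)]) auto
    have ghol: "g holomorphic_on A" if "x \<notin> A" "y \<notin> A" for A
      unfolding g_def using that by (intro holomorphic_intros) auto
    \<comment> \<open>\<open>kernel_diff_bound\<close> at radius \<open>cmod (z - x0)\<close>, with
      the powers collected and then relaxed to the smaller radius \<open>r\<close>.\<close>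
    have gbound: "cmod (g z) \<le> Ck * (d powr lam * r powr (- \<kappa>))"
      if "cc * cmod (z - x0) \<le> cmod (z - x)" "cc * cmod (z - x0) \<le> cmod (z - y)" "0 < r" "r \<le> cmod (z - x0)" for z r
    proof -
      have "cmod (g z) \<le> Ck * ((d / cmod (z - x0)) powr lam / cmod (z - x0) ^ Suc t)"
        unfolding g_def m_def Ck_def
        by (rule kernel_diff_bound[OF cc(1) _ that(1,2) d xd yd lam]) (use that in linarith)
      also have "(d / cmod (z - x0)) powr lam / cmod (z - x0) ^ Suc t = d powr lam * cmod (z - x0) powr (- \<kappa>)"
      proof -
        have p: "0 < cmod (z - x0)" using that by linarith
        have "cmod (z - x0) powr (- \<kappa>) = inverse (cmod (z - x0) powr (real (Suc t) + lam))"
          by (simp add: \<kappa>_def powr_minus[symmetric] algebra_simps)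
        also have "cmod (z - x0) powr (real (Suc t) + lam) = cmod (z - x0) ^ Suc t * cmod (z - x0) powr lam"
          using p by (simp only: powr_add powr_realpow)
        finally have A: "cmod (z - x0) powr (- \<kappa>) = inverse (cmod (z - x0) ^ Suc t * cmod (z - x0) powr lam)" .
        show ?thesis unfolding A using p d by (simp add: powr_divide field_simps del: power_Suc)
      qed
      also have "Ck * (d powr lam * cmod (z - x0) powr (- \<kappa>)) \<le> Ck * (d powr lam * r powr (- \<kappa>))"
      proof -
        have "cmod (z - x0) powr (- \<kappa>) \<le> r powr (- \<kappa>)" using that lam by (intro powr_mono2') (auto simp: \<kappa>_def)
        then show ?thesis using Ck by (intro mult_left_mono) auto
      qed
      finally show ?thesis .
    qed

    let ?c0 = "x0 - Complex \<sigma> \<sigma>" and ?s0 = "2 * \<sigma>"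
    let ?\<gamma> = "rectpath ?c0 (?c0 + Complex ?s0 ?s0)"
    have xb: "z \<noteq> x" "z \<noteq> y" if "z \<in> path_image ?\<gamma>" for z
      using boundary_Q[OF that] xd yd d\<sigma> \<sigma>(1) by auto

    have bnd: "cmod (sqint F ?c0 ?s0) \<le> C1 * M * d powr lam"
    proof -
      define d0 where "d0 = min (cmod (x - x0)) (cmod (y - x0))"
      have d0: "0 < d0" "d0 \<le> cmod (x - x0)" "d0 \<le> cmod (y - x0)" using x y by (auto simp: d0_def)
      \<comment> \<open>A crude bound for \<open>g\<close> near \<open>x0\<close>. It blows up as
        \<open>x\<close> or \<open>y\<close> approaches \<open>x0\<close>, which the choice of
        \<open>\<eta>\<close> after them compensates.\<close>
      define B0 where "B0 = 2 * (2 / d0) ^ m"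
      have B0: "0 < B0" using d0 by (simp add: B0_def)
      \<comment> \<open>The bounds serve in turn: \<open>gauge_small\<close> at
        \<open>2 * \<eta>\<close>, a radius below the side of \<open>Q\<close>, squares within
        \<open>3 * \<eta> \<le> d0 / 2\<close> of \<open>x0\<close>, and a cost of at most
        \<open>M * d powr lam\<close>.\<close>
      define \<eta> where "\<eta> = min (min (1/2) \<sigma>) (min (d0 / 6) (d powr lam / (4 * B0)))"
      have \<eta>: "0 < \<eta>" "\<eta> \<le> 1/2" "\<eta> \<le> \<sigma>" "\<eta> \<le> d0 / 6" "\<eta> \<le> d powr lam / (4 * B0)"
        using \<sigma>(1) d0 B0 d by (auto simp: \<eta>_def)
      have "lip_gauge M f (2 * \<eta>) \<le> 2 * \<eta>" using \<eta> by (intro gauge_small) auto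
      also have "\<dots> \<le> d powr lam / (2 * B0)" using \<eta>(5) B0 by (simp add: field_simps)
      finally have "2 * B0 * M * lip_gauge M f (2 * \<eta>) \<le> 2 * B0 * M * (d powr lam / (2 * B0))"
        using B0 M by (intro mult_left_mono) auto
      then have w0: "2 * B0 * M * lip_gauge M f (2 * \<eta>) \<le> M * d powr lam" using B0 by simp
      obtain b where b: "\<And>k. fine_cover (lip_gauge M f) (\<epsilon> * 2 powr (- real (Suc k))) ((Q - U) \<inter> shell x0 (Suc k)) (b k)"
        "\<And>I. finite I \<Longrightarrow> (\<Sum>k\<in>I. 2 powr (\<kappa> * real (Suc k)) * b k) \<le> S'"
        using fine_cover_shells[OF content[folded \<kappa>_def] \<epsilon>(1) P, of Q] unfolding S'_def S_def by blast
      let ?Ek = "\<lambda>k. (Q - U) \<inter> shell x0 (Suc k)"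
      let ?Pk = "\<lambda>k B. ?Ek k \<subseteq> (\<Union>p\<in>B. ball (fst p) (snd p)) \<and>
         (\<forall>p\<in>B. 0 < snd p \<and> snd p \<le> \<epsilon> * 2 powr (- real (Suc k)) \<and> ball (fst p) (snd p) \<inter> ?Ek k \<noteq> {}) \<and>
         (\<forall>T\<subseteq>B. finite T \<longrightarrow> (\<Sum>p\<in>T. lip_gauge M f (2 * snd p)) \<le> b k)"
      have "\<forall>k. \<exists>B. ?Pk k B" using b(1) unfolding fine_cover_def by (rule allI)
      from choice[OF this] obtain BB where BB': "\<forall>k. ?Pk k (BB k)" ..
      note BB = spec[OF BB', THEN conjunct1] spec[OF BB', THEN conjunct2, THEN conjunct1, THEN bspec]
        spec[OF BB', THEN conjunct2, THEN conjunct2, rule_format]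
      have b0: "0 \<le> b k" for k using BB(3)[where x = k and T = "{}"] by simp
      define Bk where "Bk k = Ck * (d powr lam * (4 powr \<kappa> * 2 powr (\<kappa> * real (Suc k))))" for k :: nat
      have Bk0: "0 \<le> Bk k" for k using Ck by (simp add: Bk_def)
      \<comment> \<open>Index 0 is reserved for \<open>x0\<close>, which lies in no shell. Tagging
        balls with the index lets a ball that occurs for several shells carry a different weight
        each time.\<close>
      define fam where "fam n = (case n of 0 \<Rightarrow> {(x0, \<eta>)} | Suc k \<Rightarrow> BB k)" for n
      define w where "w i = (case fst i of 0 \<Rightarrow> M * d powr lam | Suc k \<Rightarrow> 2 * Bk k * M * lip_gauge M f (2 * snd (snd i)))"
        for i :: "nat \<times> complex \<times> real"
      have cover: "Q - U \<subseteq> (\<Union>i\<in>Sigma UNIV fam. ball (fst (snd i)) (snd (snd i)))"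
      proof
        fix z assume z: "z \<in> Q - U"
        show "z \<in> (\<Union>i\<in>Sigma UNIV fam. ball (fst (snd i)) (snd (snd i)))"
        proof (cases "z = x0")
          case True
          have "(0, x0, \<eta>) \<in> Sigma UNIV fam" by (simp add: fam_def)
          moreover have "z \<in> ball (fst (snd (0::nat, x0, \<eta>))) (snd (snd (0::nat, x0, \<eta>)))" using True \<eta> by simp
          ultimately show ?thesis by (rule UN_I)
        next
          case False
          have "cmod (z - x0) < 1/2" using in_Q_norm[of z] z \<sigma>(3) by auto
          with False obtain k where "z \<in> shell x0 (Suc k)" using obtain_shell by blast
          then obtain p where p: "p \<in> BB k" "z \<in> ball (fst p) (snd p)" using BB(1)[of k] z by blast
          then have "(Suc k, p) \<in> Sigma UNIV fam" by (simp add: fam_def)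
          then show ?thesis by (rule UN_I) (use p in simp)
        qed
      qed
      \<comment> \<open>Compactness reduces the countable union of covers to the finite
        \<open>T\<close> that the stopping-time estimate requires.\<close>
      have "compact (Q - U)" unfolding Q_def by (intro compact_diff compact_csq U)
      obtain T where T: "T \<subseteq> Sigma UNIV fam" "finite T"
        "Q - U \<subseteq> (\<Union>i\<in>T. ball (fst (snd i)) (snd (snd i)))"
        by (rule compactE_image[OF \<open>compact (Q - U)\<close> open_ball cover])
      have Tcases: "(n = 0 \<and> p = (x0, \<eta>)) \<or> (\<exists>k. n = Suc k \<and> p \<in> BB k)" if "(n, p) \<in> T" for n p
        using that T(1) by (cases n) (auto simp: fam_def)
      have Tr: "0 < snd (snd i)" "snd (snd i) < ?s0" "0 \<le> w i" if iT: "i \<in> T" for i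
      proof -
        obtain n p where i: "i = (n, p)" by (cases i)
        consider "n = 0" "p = (x0, \<eta>)" | k where "n = Suc k" "p \<in> BB k" using Tcases[of n p] iT i by blast
        then have "0 < snd p \<and> snd p < ?s0 \<and> 0 \<le> w i"
        proof cases
          case 1
          then show ?thesis using \<eta> \<sigma>(1) M i by (auto simp: w_def)
        next
          case 2
          have "2 powr (- real (Suc k)) \<le> 2 powr 0" by (intro powr_mono) auto
          then have "\<epsilon> * 2 powr (- real (Suc k)) \<le> \<epsilon> * 1" using \<epsilon>(1) by (intro mult_left_mono) auto
          then have "snd p < ?s0" using BB(2)[OF 2(2)] \<epsilon>(2) \<sigma>(1) by linarith
          moreover have "0 \<le> lip_gauge M f (2 * snd p)" using BB(2)[OF 2(2)] by (intro gauge_nonneg) auto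
          ultimately show ?thesis using BB(2)[OF 2(2)] M Bk0[of k] i 2 by (auto simp: w_def)
        qed
        then show "0 < snd (snd i)" "snd (snd i) < ?s0" "0 \<le> w i" using i by auto
      qed
      have "cmod (sqint F ?c0 ?s0) \<le> 144 * (\<Sum>i\<in>T. w i)"
      proof (rule norm_sqint_le_sum_cover[OF T(2) Fcont Fhol])
        show "csq ?c0 ?s0 - U \<subseteq> (\<Union>i\<in>T. ball (fst (snd i)) (snd (snd i)))" using T(3) by (simp add: Q_def)
        fix i a s assume i: "i \<in> T" and sub: "csq a s \<subseteq> csq ?c0 ?s0"
          and meet: "csq a s \<inter> ball (fst (snd i)) (snd (snd i)) \<noteq> {}"
          and s: "s \<le> snd (snd i)" "snd (snd i) < 2 * s"
        obtain n p where ip: "i = (n, p)" by (cases i)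
        have r0: "0 < snd p" using Tr(1)[OF i] ip by simp
        have s0: "0 \<le> s" using s r0 ip by auto
        obtain u where u: "u \<in> csq a s" "cmod (u - fst p) < snd p"
          using meet ip by (auto simp: dist_norm norm_minus_commute)
        have close: "cmod (z - fst p) < 3 * snd p" if "z \<in> csq a s" for z
        proof -
          have "cmod (z - fst p) \<le> cmod (z - u) + cmod (u - fst p)"
            using norm_triangle_ineq[of "z - u" "u - fst p"] by simp
          moreover have "cmod (z - u) \<le> 2 * s" by (rule dist_csq_le[OF that u(1)])
          ultimately show ?thesis using u(2) s ip by simp
        qed
        have concl: "cmod (sqint F a s) \<le> 2 * B * M * lip_gauge M f (2 * snd p)"
          if "\<And>z. z \<in> csq a s \<Longrightarrow> z \<noteq> x \<and> z \<noteq> y \<and> cmod (g z) \<le> B" for B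
          by (rule norm_sqint_kernel_le[OF Fcont s0 _ Rhol ghol Feq]) (use that s ip in auto)
        consider "n = 0" "p = (x0, \<eta>)" | k where "n = Suc k" "p \<in> BB k" using Tcases[of n p] i ip by blast
        then show "cmod (sqint F a s) \<le> w i"
        proof cases
          case 1
          have "cmod (sqint F a s) \<le> 2 * B0 * M * lip_gauge M f (2 * snd p)"
          proof (rule concl)
            fix z assume "z \<in> csq a s"
            then have "cmod (z - x0) < d0 / 2" using close[of z] 1 \<eta>(4) by simp
            then have far: "d0 / 2 < cmod (z - x)" "d0 / 2 < cmod (z - y)"
              using norm_triangle_ineq4[of "z - x0" "z - x"] norm_triangle_ineq4[of "z - x0" "z - y"] d0 by simp_all
            have one: "cmod (1 / (z - v) ^ m) \<le> (2 / d0) ^ m" if "d0 / 2 < cmod (z - v)" for v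
            proof -
              have "0 < cmod (z - v)" using that d0 by linarith
              then have "1 / cmod (z - v) \<le> 2 / d0" using that d0 by (simp add: field_simps)
              then have "(1 / cmod (z - v)) ^ m \<le> (2 / d0) ^ m" by (intro power_mono) auto
              then show ?thesis by (simp add: norm_divide norm_power power_one_over)
            qed
            have "cmod (g z) \<le> cmod (1 / (z - x) ^ m) + cmod (1 / (z - y) ^ m)"
              unfolding g_def by (rule norm_triangle_ineq4)
            also have "\<dots> \<le> B0" using one[OF far(1)] one[OF far(2)] by (simp add: B0_def)
            finally show "z \<noteq> x \<and> z \<noteq> y \<and> cmod (g z) \<le> B0" using far d0 by auto
          qed
          then show ?thesis using w0 1 ip by (simp add: w_def)
        next
          case 2
          define q where "q = 2 powr (- real (Suc k))"
          have q: "0 < q" by (simp add: q_def)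
          \<comment> \<open>Covering balls meet the complement of \<open>U\<close> inside their own
            shell; the cone condition is applied at such a point \<open>e\<close>.\<close>
          obtain e where e: "e \<in> ball (fst p) (snd p)" "e \<in> Q" "e \<notin> U" "e \<in> shell x0 (Suc k)"
            using BB(2)[OF 2(2)] by blast
          have "2 powr (- real (Suc k) - 1) = q / 2"
            using powr_diff[of 2 "- real (Suc k)" 1] by (simp add: q_def del: of_nat_Suc)
          then have eq: "q / 2 \<le> cmod (e - x0)" using e(4) by (simp add: shell_def)
          have e\<rho>: "cmod (e - x0) < \<rho>" using in_Q_norm[OF e(2)] \<sigma>(2) by linarith
          have "cmod (sqint F a s) \<le> 2 * Bk k * M * lip_gauge M f (2 * snd p)"
          proof (rule concl)
            fix z assume "z \<in> csq a s"
            have "cmod (z - e) \<le> cmod (z - fst p) + cmod (fst p - e)"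
              using norm_triangle_ineq[of "z - fst p" "fst p - e"] by simp
            also have "\<dots> \<le> 4 * snd p" using close[OF \<open>z \<in> csq a s\<close>] e(1) by (simp add: dist_norm)
            also have "\<dots> \<le> 4 * (\<epsilon> * q)" using BB(2)[OF 2(2)] by (simp add: q_def)
            also have "\<dots> \<le> 4 * (\<epsilon> * (2 * cmod (e - x0)))" using eq \<epsilon>(1) by (intro mult_left_mono) auto
            also have "\<dots> = (16 * (1 + K) * \<epsilon>) * (cmod (e - x0) / (2 * (1 + K)))" using K by (simp add: field_simps)
            also have "\<dots> \<le> 1 * (cmod (e - x0) / (2 * (1 + K)))" using \<epsilon>(3) K by (intro mult_right_mono) auto
            finally have ze: "cmod (z - e) \<le> cmod (e - x0) / (2 * (1 + K))" by simp
            note nx = near_complement[OF e(3) e\<rho> x(1) ze] and ny = near_complement[OF e(3) e\<rho> y(1) ze]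
            \<comment> \<open>The quarter arises from
              \<open>cmod (z - x0) \<ge> cmod (e - x0) / 2\<close> and
              \<open>cmod (e - x0) \<ge> q / 2\<close>.\<close>
            have "cmod (g z) \<le> Ck * (d powr lam * (q / 4) powr (- \<kappa>))"
              using nx ny eq q by (intro gbound) auto
            also have "(q / 4) powr (- \<kappa>) = 4 powr \<kappa> * 2 powr (\<kappa> * real (Suc k))"
            proof -
              have "(q / 4) powr (- \<kappa>) = q powr (- \<kappa>) / 4 powr (- \<kappa>)" using q by (simp add: powr_divide)
              also have "q powr (- \<kappa>) = 2 powr (\<kappa> * real (Suc k))" by (simp add: q_def powr_powr mult.commute del: of_nat_Suc)
              finally show ?thesis by (simp add: powr_minus field_simps)
            qed
            finally show "z \<noteq> x \<and> z \<noteq> y \<and> cmod (g z) \<le> Bk k"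
              using nx(3) ny(3) eq q by (auto simp: Bk_def)
          qed
          then show ?thesis using 2 ip by (simp add: w_def)
        qed
      qed (use Tr \<sigma>(1) in auto)
      also have "(\<Sum>i\<in>T. w i) \<le> M * d powr lam + 2 * (Ck * 4 powr \<kappa>) * S' * (M * d powr lam)"
      proof -
        \<comment> \<open>Group \<open>T\<close> by shell index: within one shell the weights are a
          constant times gauge values, whose finite sums are at most \<open>b k\<close>.\<close>
        define I where "I = {k. Suc k \<in> fst ` T}"
        have I: "finite I" unfolding I_def using T(2) by (intro finite_vimageI[of "fst ` T" Suc, unfolded vimage_def]) auto
        define W where "W n = (case n of 0 \<Rightarrow> M * d powr lam | Suc k \<Rightarrow> 2 * Bk k * M * b k)" for n
        have W0: "0 \<le> W n" for n using M Bk0 b0 by (auto simp: W_def split: nat.split)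
        define Tn where "Tn n = {p. (n, p) \<in> T}" for n
        have Tn: "finite (Tn n)" for n
        proof -
          have "Tn n \<subseteq> snd ` T" by (force simp: Tn_def)
          then show ?thesis using T(2) finite_subset by blast
        qed
        have "T = Sigma (fst ` T) Tn" by (force simp: Tn_def)
        then have "(\<Sum>i\<in>T. w i) = (\<Sum>i\<in>Sigma (fst ` T) Tn. w i)" by simp
        also have "\<dots> = (\<Sum>n\<in>fst ` T. \<Sum>p\<in>Tn n. w (n, p))"
          using T(2) Tn by (subst sum.Sigma) auto
        also have "\<dots> \<le> (\<Sum>n\<in>fst ` T. W n)"
        proof (rule sum_mono)
          fix n
          show "(\<Sum>p\<in>Tn n. w (n, p)) \<le> W n"
          proof (cases n)
            case 0
            have "Tn 0 \<subseteq> {(x0, \<eta>)}" using Tcases by (auto simp: Tn_def)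
            then have "(\<Sum>p\<in>Tn 0. w (0, p)) \<le> (\<Sum>p\<in>{(x0, \<eta>)}. w (0, p))"
              using M by (intro sum_mono2) (auto simp: w_def)
            then show ?thesis using 0 by (simp add: w_def W_def)
          next
            case (Suc k)
            have "Tn n \<subseteq> BB k" using Tcases Suc by (auto simp: Tn_def)
            then have "(\<Sum>p\<in>Tn n. lip_gauge M f (2 * snd p)) \<le> b k" using Tn by (intro BB(3)) auto
            then have "2 * Bk k * M * (\<Sum>p\<in>Tn n. lip_gauge M f (2 * snd p)) \<le> 2 * Bk k * M * b k"
              using Bk0 M by (intro mult_left_mono) auto
            then show ?thesis using Suc by (simp add: w_def W_def sum_distrib_left)
          qed
        qed
        \<comment> \<open>Index 0 is added whether or not \<open>T\<close> uses it, so that its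
          contribution splits off uniformly.\<close>
        also have "\<dots> \<le> (\<Sum>n\<in>insert 0 (Suc ` I). W n)"
        proof (rule sum_mono2)
          show "fst ` T \<subseteq> insert 0 (Suc ` I)"
          proof
            fix n assume "n \<in> fst ` T"
            then show "n \<in> insert 0 (Suc ` I)" by (cases n) (auto simp: I_def)
          qed
        qed (use I W0 in auto)
        also have "\<dots> = W 0 + (\<Sum>k\<in>I. W (Suc k))"
          using I by (subst sum.insert) (auto simp: sum.reindex)
        also have "(\<Sum>k\<in>I. W (Suc k)) = 2 * (Ck * 4 powr \<kappa>) * (\<Sum>k\<in>I. 2 powr (\<kappa> * real (Suc k)) * b k) * (M * d powr lam)"
          unfolding sum_distrib_left sum_distrib_right by (intro sum.cong) (auto simp: W_def Bk_def)
        also have "\<dots> \<le> 2 * (Ck * 4 powr \<kappa>) * S' * (M * d powr lam)"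
          using b(2)[OF I] Ck M by (intro mult_right_mono mult_left_mono) auto
        finally show ?thesis by (simp add: W_def)
      qed
      finally show ?thesis by (simp add: C1_def algebra_simps)
    qed

    \<comment> \<open>On the boundary of \<open>Q\<close> the distance to \<open>x0\<close> is at
      least \<open>\<sigma> \<ge> 2 * d\<close>, so \<open>x\<close> and \<open>y\<close> are at
      least half as far away as \<open>x0\<close>.\<close>
    have "cmod (sqint (\<lambda>z. f z * g z) ?c0 ?s0) \<le> 4 * ?s0 * (M * (Ck * (d powr lam * \<sigma> powr (- \<kappa>))))"
    proof (rule norm_sqint_le)
      have "continuous_on (path_image ?\<gamma>) g"
        by (rule holomorphic_on_imp_continuous_on, rule ghol) (use xb in blast)+
      then show "continuous_on (path_image ?\<gamma>) (\<lambda>z. f z * g z)" by (intro continuous_intros continuous_f)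
      fix z assume z: "z \<in> path_image ?\<gamma>"
      have r: "\<sigma> \<le> cmod (z - x0)" by (rule boundary_Q[OF z])
      have "cc * cmod (z - x0) \<le> 1/4 * cmod (z - x0)" using cc by (intro mult_right_mono) auto
      moreover have "cmod (z - x0) \<le> cmod (z - x) + cmod (x - x0)" "cmod (z - x0) \<le> cmod (z - y) + cmod (y - x0)"
        using norm_triangle_ineq[of "z - x" "x - x0"] norm_triangle_ineq[of "z - y" "y - x0"] by simp_all
      ultimately have "cmod (g z) \<le> Ck * (d powr lam * \<sigma> powr (- \<kappa>))"
        using r xd yd d\<sigma> \<sigma>(1) by (intro gbound) linarith+
      then show "cmod (f z * g z) \<le> M * (Ck * (d powr lam * \<sigma> powr (- \<kappa>)))"
        unfolding norm_mult using f_le[of z] M by (intro mult_mono) auto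
    qed (use \<sigma>(1) M Ck in auto)
    then have fg: "cmod (sqint (\<lambda>z. f z * g z) ?c0 ?s0) \<le> C2 * M * d powr lam"
      by (simp add: C2_def mult_ac)
    have wind: "winding_number ?\<gamma> z = 1" if "cmod (z - x0) \<le> d" for z
    proof (rule winding_number_rectpath)
      have "\<bar>Re (z - x0)\<bar> < \<sigma>" "\<bar>Im (z - x0)\<bar> < \<sigma>"
        using abs_Re_le_cmod[of "z - x0"] abs_Im_le_cmod[of "z - x0"] that d\<sigma> \<sigma>(1) by linarith+
      then show "z \<in> box ?c0 (?c0 + Complex ?s0 ?s0)" by (auto simp: in_box_complex_iff)
    qed
    have Rint: "(R has_contour_integral (2 * pi * \<i> * 1 * ((deriv ^^ t) f x / fact t) - 2 * pi * \<i> * 1 * ((deriv ^^ t) f y / fact t))) ?\<gamma>"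
      unfolding R_def using fx(5)[of ?\<gamma>] fy(5)[of ?\<gamma>] xb xd yd wind
      by (intro has_contour_integral_diff) auto
    have "(F has_contour_integral sqint F ?c0 ?s0) ?\<gamma>"
      unfolding sqint_def by (intro has_contour_integral_integral sqint_sides(2) Fcont)
    \<comment> \<open>The integral of \<open>f g\<close> is that of \<open>F\<close> plus that of
      \<open>R\<close>, and the latter carries the difference of the derivatives because both points
      have winding number 1.\<close>
    from has_contour_integral_add[OF this Rint]
    have "((\<lambda>z. f z * g z) has_contour_integral (sqint F ?c0 ?s0 +
       (2 * pi * \<i> * 1 * ((deriv ^^ t) f x / fact t) - 2 * pi * \<i> * 1 * ((deriv ^^ t) f y / fact t)))) ?\<gamma>"
      by (rule has_contour_integral_eq) (use xb Feq in force)
    then have "sqint (\<lambda>z. f z * g z) ?c0 ?s0 = sqint F ?c0 ?s0 +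
       (2 * pi * \<i> * 1 * ((deriv ^^ t) f x / fact t) - 2 * pi * \<i> * 1 * ((deriv ^^ t) f y / fact t))"
      unfolding sqint_def by (rule contour_integral_unique)
    then have "2 * pi * \<i> / fact t * ((deriv ^^ t) f x - (deriv ^^ t) f y) = sqint (\<lambda>z. f z * g z) ?c0 ?s0 - sqint F ?c0 ?s0"
      by (simp add: algebra_simps diff_divide_distrib)
    then have "cmod (2 * pi * \<i> / fact t * ((deriv ^^ t) f x - (deriv ^^ t) f y)) \<le> C2 * M * d powr lam + C1 * M * d powr lam"
      using fg bnd norm_triangle_ineq4[of "sqint (\<lambda>z. f z * g z) ?c0 ?s0" "sqint F ?c0 ?s0"] by simp
    moreover have "cmod (2 * pi * \<i> / fact t * \<Delta>) = 2 * pi / fact t * cmod \<Delta>" for \<Delta> :: complex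
      by (simp add: norm_mult norm_divide)
    ultimately have "2 * pi / fact t * cmod ((deriv ^^ t) f x - (deriv ^^ t) f y) \<le> C2 * M * d powr lam + C1 * M * d powr lam"
      by simp
    then have "fact t * (2 * pi / fact t * cmod ((deriv ^^ t) f x - (deriv ^^ t) f y)) \<le> fact t * (C2 * M * d powr lam + C1 * M * d powr lam)"
      by (intro mult_left_mono) auto
    then have A: "2 * pi * cmod ((deriv ^^ t) f x - (deriv ^^ t) f y) \<le> fact t * (C2 * M * d powr lam + C1 * M * d powr lam)"
      by simp
    have "1 * cmod ((deriv ^^ t) f x - (deriv ^^ t) f y) \<le> 2 * pi * cmod ((deriv ^^ t) f x - (deriv ^^ t) f y)"
      using pi_gt3 by (intro mult_right_mono) auto
    moreover have "fact t * (C2 * M * d powr lam + C1 * M * d powr lam) = C * M * d powr lam"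
      by (simp add: C_def algebra_simps)
    ultimately show ?thesis using A by linarith
  qed
  ultimately show ?thesis by (intro exI[of _ C]) auto
qed

end

section \<open>The point derivation\<close>

lemma lip_norm_bounds:
  assumes f: "f \<in> Lip \<alpha>"
  shows "cmod (f z) \<le> lip_norm \<alpha> f" "cmod (f z - f w) \<le> lip_norm \<alpha> f * cmod (z - w) powr \<alpha>" "0 \<le> lip_norm \<alpha> f"
proof -
  obtain k where k: "k > 0" "\<And>z w. cmod (f z - f w) \<le> k * cmod (z - w) powr \<alpha>" and bd: "bounded (range f)"
    using f unfolding Lip_def by blast
  \<comment> \<open>Real suprema bound their members only for families bounded above; membership in
    \<open>Lip \<alpha>\<close> provides this for both parts of the norm.\<close>
  have "bdd_above (range (\<lambda>z. cmod (f z)))"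
    using bd unfolding bounded_iff by (force intro: bdd_aboveI2)
  then have s: "cmod (f z) \<le> (SUP z. cmod (f z))" for z by (intro cSUP_upper) auto
  have "bdd_above ((\<lambda>p. cmod (f (fst p) - f (snd p)) / cmod (fst p - snd p) powr \<alpha>) ` {(z, w). z \<noteq> w})"
  proof (rule bdd_aboveI2)
    fix p :: "complex \<times> complex" assume "p \<in> {(z, w). z \<noteq> w}"
    then have "0 < cmod (fst p - snd p) powr \<alpha>" by auto
    then show "cmod (f (fst p) - f (snd p)) / cmod (fst p - snd p) powr \<alpha> \<le> k"
      using k(2)[of "fst p" "snd p"] by (simp add: pos_divide_le_eq)
  qed
  then have q: "cmod (f z - f w) / cmod (z - w) powr \<alpha> \<le> lip_const \<alpha> f" if "z \<noteq> w" for z w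
    unfolding lip_const_def using cSUP_upper[of "(z, w)" "{(z, w). z \<noteq> w}"] that by fastforce
  have c0: "0 \<le> lip_const \<alpha> f"
    by (rule order_trans[OF _ q[of 0 1]]) auto
  have s0: "0 \<le> (SUP z. cmod (f z))" by (rule order_trans[OF _ s[of 0]]) auto
  show "cmod (f z) \<le> lip_norm \<alpha> f" "0 \<le> lip_norm \<alpha> f"
    using s[of z] c0 s0 by (auto simp: lip_norm_def)
  show "cmod (f z - f w) \<le> lip_norm \<alpha> f * cmod (z - w) powr \<alpha>"
  proof (cases "z = w")
    case False
    then have "0 < cmod (z - w) powr \<alpha>" by auto
    then have "cmod (f z - f w) \<le> lip_const \<alpha> f * cmod (z - w) powr \<alpha>"
      using q[OF False] by (simp add: pos_divide_le_eq)
    also have "\<dots> \<le> lip_norm \<alpha> f * cmod (z - w) powr \<alpha>"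
      using s0 by (intro mult_right_mono) (auto simp: lip_norm_def)
    finally show ?thesis .
  qed simp
qed

text \<open>The norm itself may vanish while \<open>lip_fun\<close> asks for a positive bound;
  \<open>e\<close> is removed later by letting it tend to 0.\<close>

lemma lip_fun_lip_norm:
  assumes "0 < \<alpha>" "\<alpha> < 1" "f \<in> lip \<alpha>" "0 < e"
  shows "lip_fun \<alpha> (lip_norm \<alpha> f + e) f"
proof
  have L: "f \<in> Lip \<alpha>" using assms(3) by (simp add: lip_def)
  note N = lip_norm_bounds[OF L]
  show "0 < lip_norm \<alpha> f + e" using N(3) assms(4) by simp
  show "cmod (f z) \<le> lip_norm \<alpha> f + e" for z using N(1)[of z] assms(4) by simp
  show "cmod (f z - f w) \<le> (lip_norm \<alpha> f + e) * cmod (z - w) powr \<alpha>" for z w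
    using N(2)[of z w] assms(4) by (simp add: distrib_right add_increasing2)
qed (use assms in auto)

lemma lip_diff:
  assumes f: "f \<in> lip \<alpha>" and g: "g \<in> lip \<alpha>"
  shows "(\<lambda>z. f z - g z) \<in> lip \<alpha>"
proof -
  have tri: "cmod (f z - g z - (f w - g w)) \<le> cmod (f z - f w) + cmod (g z - g w)" for z w
    using norm_triangle_ineq4[of "f z - f w" "g z - g w"] by (simp add: algebra_simps)
  obtain k where k: "k > 0" "\<And>z w. cmod (f z - f w) \<le> k * cmod (z - w) powr \<alpha>" and bf: "bounded (range f)"
    using f unfolding lip_def Lip_def by blast
  obtain k' where k': "k' > 0" "\<And>z w. cmod (g z - g w) \<le> k' * cmod (z - w) powr \<alpha>" and bg: "bounded (range g)"
    using g unfolding lip_def Lip_def by blast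
  have "(\<lambda>z. f z - g z) \<in> Lip \<alpha>"
    unfolding Lip_def mem_Collect_eq
  proof (intro conjI exI[of _ "k + k'"] allI)
    show "bounded (range (\<lambda>z. f z - g z))" by (rule bounded_minus_comp[OF bf bg])
    show "cmod (f z - g z - (f w - g w)) \<le> (k + k') * cmod (z - w) powr \<alpha>" for z w
      using tri[of z w] k(2)[of z w] k'(2)[of z w] by (simp add: distrib_right)
  qed (use k k' in auto)
  moreover have "\<exists>\<delta>>0. \<forall>z w. cmod (z - w) < \<delta> \<longrightarrow> cmod (f z - g z - (f w - g w)) \<le> e * cmod (z - w) powr \<alpha>"
    if e: "0 < e" for e
  proof -
    have e2: "0 < e / 2" using e by simp
    obtain d where d: "d > 0" "\<And>z w. cmod (z - w) < d \<Longrightarrow> cmod (f z - f w) \<le> e/2 * cmod (z - w) powr \<alpha>"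
      using f e2 unfolding lip_def by blast
    obtain d' where d': "d' > 0" "\<And>z w. cmod (z - w) < d' \<Longrightarrow> cmod (g z - g w) \<le> e/2 * cmod (z - w) powr \<alpha>"
      using g e2 unfolding lip_def by blast
    show ?thesis
    proof (intro exI[of _ "min d d'"] conjI allI impI)
      fix z w assume "cmod (z - w) < min d d'"
      then show "cmod (f z - g z - (f w - g w)) \<le> e * cmod (z - w) powr \<alpha>"
        using tri[of z w] d(2)[of z w] d'(2)[of z w] by simp
    qed (use d d' in auto)
  qed
  ultimately show ?thesis by (simp add: lip_def)
qed

lemma higher_deriv_bound_ball:
  assumes "f holomorphic_on ball x r" "continuous_on UNIV f" "\<And>z. cmod (f z) \<le> M" "0 < M" "0 < r"
  shows "cmod ((deriv ^^ n) f x) \<le> fact n * 2 / r ^ n * M"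
proof (cases "n = 0")
  case True
  then show ?thesis using assms(3)[of x] assms(4) by simp
next
  case False
  \<comment> \<open>\<open>Cauchy_higher_deriv_bound\<close> asks for a strict bound and a positive
    order, whence the factor 2 and the case distinction.\<close>
  have "cmod (f z) < 2 * M" for z using assms(3)[of z] assms(4) by simp
  then have "cmod ((deriv ^^ n) f x) \<le> fact n * (2 * M) / r ^ n"
    using assms False by (intro Cauchy_higher_deriv_bound[where y = 0]) (auto intro: continuous_on_subset)
  then show ?thesis by (simp add: mult_ac)
qed

section \<open>Limits of the derivative along the ray\<close>

context cone_point
begin

text \<open>The oscillation estimate makes the derivatives along \<open>Y\<close> Cauchy. Letting
  \<open>y\<close> run through \<open>Y\<close> gives the claim for \<open>x\<close> near
  \<open>x0\<close>; a Cauchy estimate at \<open>Y 0\<close> bounds \<open>v\<close>, and one at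
  \<open>x\<close> handles the rest of \<open>J\<close>.\<close>

lemma deriv_limit_bound:
  assumes Y: "\<And>n. Y n \<in> J - {x0}" "\<And>n. cmod (Y n - x0) \<le> \<sigma> / 2" "Y \<longlonglongrightarrow> x0"
  shows "\<exists>C>0. \<forall>M f. lip_fun \<alpha> M f \<longrightarrow> f holomorphic_on U \<longrightarrow>
     (\<exists>v. (\<lambda>n. (deriv ^^ t) f (Y n)) \<longlonglongrightarrow> v \<and> cmod v \<le> C * M \<and>
       (\<forall>x\<in>J - {x0}. cmod ((deriv ^^ t) f x - v) \<le> C * M * cmod (x - x0) powr lam))"
proof -
  obtain C where C: "0 < C" "\<And>M f x y d. lip_fun \<alpha> M f \<Longrightarrow> f holomorphic_on U \<Longrightarrow> x \<in> J - {x0} \<Longrightarrow> y \<in> J - {x0} \<Longrightarrow>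
     cmod (x - x0) \<le> d \<Longrightarrow> cmod (y - x0) \<le> d \<Longrightarrow> d \<le> \<sigma> / 2 \<Longrightarrow>
     cmod ((deriv ^^ t) f x - (deriv ^^ t) f y) \<le> C * M * d powr lam"
    using deriv_oscillation by (elim exE conjE) (rule that, auto)
  define q where "q n = cmod (Y n - x0)" for n
  have q0: "0 < q n" for n using Y(1)[of n] by (auto simp: q_def)
  have q: "q \<longlonglongrightarrow> 0" using Y(3) unfolding q_def by (simp add: LIM_zero_iff tendsto_norm_zero_iff)
  obtain r1 where r1: "0 < r1" "ball (Y 0) r1 \<subseteq> U" using Y(1)[of 0] J(1) U open_contains_ball by blast
  \<comment> \<open>A disc radius that works for all \<open>x\<close> in \<open>J\<close> farther
    than \<open>\<sigma> / 2\<close> from \<open>x0\<close>: a point of the disc outside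
    \<open>U\<close> would be within \<open>\<rho>\<close> of \<open>x0\<close>, and
    \<open>cone\<close> would then force \<open>cmod (x - x0) < \<sigma> / 2\<close>.\<close>
  define r2 where "r2 = min (\<rho> - L) (\<sigma> / (2 * K))"
  have r2: "0 < r2" using J(3) \<sigma>(1) K by (simp add: r2_def)
  define D where "D r = fact t * 2 / r ^ t" for r :: real
  have D: "0 < r \<Longrightarrow> 0 < D r" for r by (simp add: D_def)
  define V where "V = C * (\<sigma> / 2) powr lam + D r1"
  \<comment> \<open>The summands serve near points, the bound on \<open>v\<close> and far points;
    for the last, \<open>cmod (x - x0)\<close> exceeds \<open>\<sigma> / 2\<close>, hence the
    denominator.\<close>
  define C' where "C' = C + V + (D r2 + V) / (\<sigma> / 2) powr lam"
  have V: "0 < V" using C D r1 by (auto simp: V_def intro!: add_nonneg_pos)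
  have s2: "0 < (\<sigma> / 2) powr lam" using \<sigma> by simp
  have C': "0 < C'" "C \<le> C'" "V \<le> C'" "(D r2 + V) / (\<sigma> / 2) powr lam \<le> C'"
    using C V D[OF r2] s2 by (auto simp: C'_def intro!: add_pos_pos add_nonneg_nonneg)
  have "\<exists>v. (\<lambda>n. (deriv ^^ t) f (Y n)) \<longlonglongrightarrow> v \<and> cmod v \<le> C' * M \<and>
       (\<forall>x\<in>J - {x0}. cmod ((deriv ^^ t) f x - v) \<le> C' * M * cmod (x - x0) powr lam)"
    if lf: "lip_fun \<alpha> M f" and f: "f holomorphic_on U" for M f
  proof -
    interpret lip_fun \<alpha> M f by fact
    have "(\<lambda>n. C * M * q n powr lam) \<longlonglongrightarrow> C * M * 0"
      using lam q0 by (intro tendsto_mult tendsto_const tendsto_zero_powrI[OF q tendsto_const]) (auto simp: less_imp_le)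
    then have z: "(\<lambda>n. C * M * q n powr lam) \<longlonglongrightarrow> 0" by simp
    have "Cauchy (\<lambda>n. (deriv ^^ t) f (Y n))"
    proof (rule CauchyI)
      fix e :: real assume "0 < e"
      then obtain N where N: "\<And>n. n \<ge> N \<Longrightarrow> C * M * q n powr lam < e"
        using order_tendstoD(2)[OF z, of e] by (auto simp: eventually_sequentially)
      have "cmod ((deriv ^^ t) f (Y m) - (deriv ^^ t) f (Y n)) < e" if "m \<ge> N" "n \<ge> N" for m n
      proof -
        have "cmod ((deriv ^^ t) f (Y m) - (deriv ^^ t) f (Y n)) \<le> C * M * (max (q m) (q n)) powr lam"
          by (rule C(2)[OF lf f Y(1) Y(1)]) (use Y(2)[of m] Y(2)[of n] in \<open>auto simp: q_def max_def\<close>)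
        also have "\<dots> < e" using N that by (auto simp: max_def)
        finally show ?thesis .
      qed
      then show "\<exists>N. \<forall>m\<ge>N. \<forall>n\<ge>N. cmod ((deriv ^^ t) f (Y m) - (deriv ^^ t) f (Y n)) < e" by blast
    qed
    then obtain v where v: "(\<lambda>n. (deriv ^^ t) f (Y n)) \<longlonglongrightarrow> v"
      using Cauchy_convergent_iff convergent_def by blast
    have near: "cmod ((deriv ^^ t) f x - v) \<le> C * M * cmod (x - x0) powr lam"
      if x: "x \<in> J - {x0}" "cmod (x - x0) \<le> \<sigma> / 2" for x
    proof (rule tendsto_upperbound)
      show "(\<lambda>n. cmod ((deriv ^^ t) f x - (deriv ^^ t) f (Y n))) \<longlonglongrightarrow> cmod ((deriv ^^ t) f x - v)"
        by (intro tendsto_intros v)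
      \<comment> \<open>Eventually \<open>Y n\<close> is closer to \<open>x0\<close> than
        \<open>x\<close>, so \<open>d\<close> can be taken to be
        \<open>cmod (x - x0)\<close>.\<close>
      have "\<forall>\<^sub>F n in sequentially. q n < cmod (x - x0)"
        using order_tendstoD(2)[OF q, of "cmod (x - x0)"] x by auto
      then show "\<forall>\<^sub>F n in sequentially. cmod ((deriv ^^ t) f x - (deriv ^^ t) f (Y n)) \<le> C * M * cmod (x - x0) powr lam"
        by eventually_elim (rule C(2)[OF lf f x(1) Y(1)], use x in \<open>auto simp: q_def\<close>)
    qed auto
    have "cmod v \<le> cmod ((deriv ^^ t) f (Y 0) - v) + cmod ((deriv ^^ t) f (Y 0))"
      using norm_triangle_ineq4[of "(deriv ^^ t) f (Y 0)" "(deriv ^^ t) f (Y 0) - v"] by simp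
    also have "\<dots> \<le> C * M * (\<sigma> / 2) powr lam + D r1 * M"
    proof (rule add_mono)
      have "q 0 powr lam \<le> (\<sigma> / 2) powr lam" using Y(2)[of 0] lam by (intro powr_mono2) (auto simp: q_def)
      then have "C * M * q 0 powr lam \<le> C * M * (\<sigma> / 2) powr lam" using C M by (intro mult_left_mono) auto
      then show "cmod ((deriv ^^ t) f (Y 0) - v) \<le> C * M * (\<sigma> / 2) powr lam"
        using near[OF Y(1) Y(2), of 0] by (simp add: q_def)
      show "cmod ((deriv ^^ t) f (Y 0)) \<le> D r1 * M"
        unfolding D_def using r1 f M
        by (intro higher_deriv_bound_ball continuous_f f_le) (auto intro: holomorphic_on_subset)
    qed
    also have "\<dots> = V * M" by (simp add: V_def algebra_simps)
    finally have vV: "cmod v \<le> V * M" .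
    have "cmod ((deriv ^^ t) f x - v) \<le> C' * M * cmod (x - x0) powr lam" if x: "x \<in> J - {x0}" for x
    proof (cases "cmod (x - x0) \<le> \<sigma> / 2")
      case True
      have "C * M * cmod (x - x0) powr lam \<le> C' * M * cmod (x - x0) powr lam"
        using C' M by (intro mult_right_mono) auto
      then show ?thesis using near[OF x True] by linarith
    next
      case False
      have "ball x r2 \<subseteq> U"
      proof (rule ccontr)
        assume "\<not> ball x r2 \<subseteq> U"
        then obtain z where "z \<in> ball x r2" "z \<notin> U" by blast
        then have z: "z \<notin> U" "cmod (z - x) < r2" by (simp_all add: dist_norm norm_minus_commute)
        have "cmod (z - x0) \<le> cmod (z - x) + cmod (x - x0)"
          using norm_triangle_ineq[of "z - x" "x - x0"] by simp
        also have "\<dots> < \<rho>" using z(2) J(2)[of x] x by (auto simp: r2_def)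
        finally have "cmod (x - x0) \<le> K * cmod (z - x)" using cone[of x z] x z by auto
        also have "\<dots> < K * (\<sigma> / (2 * K))" using z(2) K by (intro mult_strict_left_mono) (auto simp: r2_def)
        also have "\<dots> = \<sigma> / 2" using K by simp
        finally show False using False by simp
      qed
      then have "cmod ((deriv ^^ t) f x) \<le> D r2 * M"
        unfolding D_def using r2 f M
        by (intro higher_deriv_bound_ball continuous_f f_le) (auto intro: holomorphic_on_subset)
      then have "cmod ((deriv ^^ t) f x - v) \<le> (D r2 + V) * M"
        using vV norm_triangle_ineq4[of "(deriv ^^ t) f x" v] by (simp add: distrib_right)
      also have "\<dots> = (D r2 + V) / (\<sigma> / 2) powr lam * M * (\<sigma> / 2) powr lam" using s2 by simp
      also have "\<dots> \<le> C' * M * cmod (x - x0) powr lam"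
      proof (intro mult_mono C'(4) powr_mono2)
      qed (use False \<sigma>(1) lam M C'(1) in auto)
      finally show ?thesis .
    qed
    moreover have "cmod v \<le> C' * M" using vV C'(3) M by (meson less_imp_le mult_right_mono order_trans)
    ultimately show ?thesis using v by blast
  qed
  with C'(1) show ?thesis by blast
qed

text \<open>The limit \<open>v\<close> along \<open>Y\<close> is the value of the extension. If
  \<open>g\<close> is analytic near \<open>x0\<close>, then the limit for \<open>g - f\<close> is
  the derivative of \<open>g\<close> at \<open>x0\<close> minus \<open>v\<close>, so the bound on
  limits, applied to \<open>g - f\<close>, gives convergence whenever the norms tend to 0.\<close>

lemma bounded_point_derivation:
  assumes Y: "\<And>n. Y n \<in> J - {x0}" "\<And>n. cmod (Y n - x0) \<le> \<sigma> / 2" "Y \<longlonglongrightarrow> x0"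
  shows "\<exists>C>0. \<forall>f \<in> A_alpha \<alpha> U. \<exists>v. is_bpd_ext \<alpha> U x0 t f v \<and>
     (\<forall>x \<in> J. x \<noteq> x0 \<longrightarrow> cmod ((deriv ^^ t) f x - v) / cmod (x - x0) powr lam \<le> C * lip_norm \<alpha> f)"
proof -
  obtain C where C: "0 < C" "\<And>M f. lip_fun \<alpha> M f \<Longrightarrow> f holomorphic_on U \<Longrightarrow>
     \<exists>v. (\<lambda>n. (deriv ^^ t) f (Y n)) \<longlonglongrightarrow> v \<and> cmod v \<le> C * M \<and>
       (\<forall>x\<in>J - {x0}. cmod ((deriv ^^ t) f x - v) \<le> C * M * cmod (x - x0) powr lam)"
    using deriv_limit_bound[OF Y] by blast
  have "\<exists>v. is_bpd_ext \<alpha> U x0 t f v \<and>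
     (\<forall>x \<in> J. x \<noteq> x0 \<longrightarrow> cmod ((deriv ^^ t) f x - v) / cmod (x - x0) powr lam \<le> C * lip_norm \<alpha> f)"
    if fA: "f \<in> A_alpha \<alpha> U" for f
  proof -
    have f: "f \<in> lip \<alpha>" "f holomorphic_on U" using fA by (auto simp: A_alpha_def)
    have L: "lip_fun \<alpha> (lip_norm \<alpha> f + e) f" if "0 < e" for e
      by (rule lip_fun_lip_norm[OF \<alpha> f(1) that])
    obtain v where v: "(\<lambda>n. (deriv ^^ t) f (Y n)) \<longlonglongrightarrow> v" using C(2)[OF L[OF zero_less_one] f(2)] by blast
    have bound: "cmod ((deriv ^^ t) f x - v) / cmod (x - x0) powr lam \<le> C * lip_norm \<alpha> f" if x: "x \<in> J" "x \<noteq> x0" for x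
    proof (rule field_le_epsilon)
      fix e :: real assume e: "0 < e"
      \<comment> \<open>The bound is available only for the enlarged norm, but limits are unique, so
        \<open>v\<close> does not depend on \<open>e\<close>.\<close>
      obtain v' where v': "(\<lambda>n. (deriv ^^ t) f (Y n)) \<longlonglongrightarrow> v'"
        "\<forall>x\<in>J - {x0}. cmod ((deriv ^^ t) f x - v') \<le> C * (lip_norm \<alpha> f + e / C) * cmod (x - x0) powr lam"
        using C(2)[OF L[of "e / C"] f(2)] e C(1) by auto
      have "v' = v" using LIMSEQ_unique[OF v'(1) v] .
      then have "cmod ((deriv ^^ t) f x - v) \<le> C * (lip_norm \<alpha> f + e / C) * cmod (x - x0) powr lam"
        using v'(2) x by auto
      also have "C * (lip_norm \<alpha> f + e / C) = C * lip_norm \<alpha> f + e" using C(1) by (simp add: field_simps)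
      finally show "cmod ((deriv ^^ t) f x - v) / cmod (x - x0) powr lam \<le> C * lip_norm \<alpha> f + e"
        using x by (simp add: pos_divide_le_eq)
    qed
    have "is_bpd_ext \<alpha> U x0 t f v"
      unfolding is_bpd_ext_def
    proof (intro allI impI, elim conjE)
      fix g assume g: "\<forall>n. g n \<in> A_alpha_near \<alpha> U x0" and lim: "(\<lambda>n. lip_norm \<alpha> (\<lambda>z. g n z - f z)) \<longlonglongrightarrow> 0"
      \<comment> \<open>The slack \<open>inverse (real (Suc n))\<close> covers differences of norm 0
        and vanishes in the limit.\<close>
      have "cmod ((deriv ^^ t) (g n) x0 - v) \<le> C * (lip_norm \<alpha> (\<lambda>z. g n z - f z) + inverse (real (Suc n)))" for n
      proof -
        define u where "u = (\<lambda>z. g n z - f z)"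
        obtain N where gn: "g n \<in> lip \<alpha>" "g n holomorphic_on U" and N: "open N" "x0 \<in> N" "g n holomorphic_on N"
          using g by (auto simp: A_alpha_near_def A_alpha_def)
        have u: "u \<in> lip \<alpha>" "u holomorphic_on U" unfolding u_def
          by (rule lip_diff[OF gn(1) f(1)]) (intro holomorphic_intros gn f)
        have "lip_fun \<alpha> (lip_norm \<alpha> u + inverse (real (Suc n))) u" by (rule lip_fun_lip_norm[OF \<alpha> u(1)]) simp
        then obtain v' where v': "(\<lambda>k. (deriv ^^ t) u (Y k)) \<longlonglongrightarrow> v'" "cmod v' \<le> C * (lip_norm \<alpha> u + inverse (real (Suc n)))"
          using C(2) u(2) by blast
        have "isCont ((deriv ^^ t) (g n)) x0"
          using holomorphic_on_imp_continuous_on[OF holomorphic_higher_deriv[OF N(3,1)]] N by (simp add: continuous_on_eq_continuous_at)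
        then have "(\<lambda>k. (deriv ^^ t) (g n) (Y k)) \<longlonglongrightarrow> (deriv ^^ t) (g n) x0"
          using Y(3) isCont_tendsto_compose by blast
        then have "(\<lambda>k. (deriv ^^ t) (g n) (Y k) - (deriv ^^ t) f (Y k)) \<longlonglongrightarrow> (deriv ^^ t) (g n) x0 - v"
          using v by (rule tendsto_diff)
        moreover have "(deriv ^^ t) u (Y k) = (deriv ^^ t) (g n) (Y k) - (deriv ^^ t) f (Y k)" for k
          unfolding u_def by (rule higher_deriv_diff[OF gn(2) f(2) U]) (use Y(1) J(1) in blast)
        ultimately have "(\<lambda>k. (deriv ^^ t) u (Y k)) \<longlonglongrightarrow> (deriv ^^ t) (g n) x0 - v" by simp
        from LIMSEQ_unique[OF v'(1) this] have "v' = (deriv ^^ t) (g n) x0 - v" .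
        then show ?thesis using v'(2) by (simp add: u_def)
      qed
      then have le: "\<forall>\<^sub>F n in sequentially. norm ((deriv ^^ t) (g n) x0 - v)
          \<le> C * (lip_norm \<alpha> (\<lambda>z. g n z - f z) + inverse (real (Suc n)))"
        by (intro always_eventually allI)
      have "(\<lambda>n. C * (lip_norm \<alpha> (\<lambda>z. g n z - f z) + inverse (real (Suc n)))) \<longlonglongrightarrow> C * (0 + 0)"
        by (intro tendsto_intros lim LIMSEQ_inverse_real_of_nat)
      then have "(\<lambda>n. C * (lip_norm \<alpha> (\<lambda>z. g n z - f z) + inverse (real (Suc n)))) \<longlonglongrightarrow> 0" by simp
      with le have "(\<lambda>n. (deriv ^^ t) (g n) x0 - v) \<longlonglongrightarrow> 0" by (rule Lim_null_comparison)
      then show "(\<lambda>n. (deriv ^^ t) (g n) x0) \<longlonglongrightarrow> v" by (simp add: LIM_zero_iff)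
    qed
    with bound show ?thesis by blast
  qed
  with C(1) show ?thesis by blast
qed

end

theorem theorem5:
  fixes \<alpha> lam \<theta>0 \<beta> \<rho> L K :: real and U :: "complex set" and x0 :: complex and t :: nat
  assumes "0 < \<alpha>" "\<alpha> < 1"
    and "open U" "x0 \<in> frontier U"
    and "0 < \<beta>" "\<beta> \<le> pi" "0 < \<rho>" "sector x0 \<theta>0 \<beta> \<inter> ball x0 \<rho> \<subseteq> U"
    and "0 < L" "L < \<rho>" "K > 0"
    and "\<forall>x \<in> closed_segment x0 (x0 + of_real L * cis \<theta>0). \<forall>z. z \<notin> sector x0 \<theta>0 \<beta> \<longrightarrow>
            cmod (x - x0) \<le> K * cmod (z - x)"
    and "0 < lam" "lam < 1"
    and "(\<Sum>n. ennreal (2 powr ((real t + 1 + lam) * real (Suc n)))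
              * lower_content \<alpha> (annulus x0 (Suc n) - U)) < \<infinity>"
  shows "\<exists>C>0. \<forall>f \<in> A_alpha \<alpha> U. \<exists>v. is_bpd_ext \<alpha> U x0 t f v \<and>
           (\<forall>x \<in> closed_segment x0 (x0 + of_real L * cis \<theta>0). x \<noteq> x0 \<longrightarrow>
              cmod ((deriv ^^ t) f x - v) / cmod (x - x0) powr lam \<le> C * lip_norm \<alpha> f)"
proof -
  define J where "J = closed_segment x0 (x0 + of_real L * cis \<theta>0)"
  \<comment> \<open>Parametrise the segment by the distance \<open>s\<close> from \<open>x0\<close>,
    the form in which \<open>sector\<close> describes its points.\<close>
  have in_J: "x \<in> J \<longleftrightarrow> (\<exists>s. 0 \<le> s \<and> s \<le> L \<and> x = x0 + of_real s * cis \<theta>0)" for x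
  proof
    assume "x \<in> J"
    then obtain u where u: "0 \<le> u" "u \<le> 1" "x = (1 - u) *\<^sub>R x0 + u *\<^sub>R (x0 + of_real L * cis \<theta>0)"
      unfolding J_def closed_segment_def by blast
    then show "\<exists>s. 0 \<le> s \<and> s \<le> L \<and> x = x0 + of_real s * cis \<theta>0"
      using \<open>0 < L\<close> by (intro exI[of _ "u * L"]) (auto simp: scaleR_conv_of_real algebra_simps mult_left_le_one_le)
  next
    assume "\<exists>s. 0 \<le> s \<and> s \<le> L \<and> x = x0 + of_real s * cis \<theta>0"
    then obtain s where s: "0 \<le> s" "s \<le> L" "x = x0 + of_real s * cis \<theta>0" by blast
    then have "x = (1 - s / L) *\<^sub>R x0 + (s / L) *\<^sub>R (x0 + of_real L * cis \<theta>0)"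
      using \<open>0 < L\<close> by (simp add: scaleR_conv_of_real algebra_simps)
    then show "x \<in> J" unfolding J_def closed_segment_def using s \<open>0 < L\<close> by (intro CollectI exI[of _ "s / L"]) auto
  qed
  interpret cone_point \<alpha> lam \<rho> L K U J x0 t
  proof
    show "J - {x0} \<subseteq> U"
    proof
      fix x assume "x \<in> J - {x0}"
      then obtain s where s: "0 < s" "s \<le> L" "x = x0 + of_real s * cis \<theta>0" using in_J[of x] by (auto simp: less_le)
      then have "x \<in> sector x0 \<theta>0 \<beta>" unfolding sector_def using \<open>0 < \<beta>\<close> by (intro CollectI exI[of _ s] exI[of _ 0] conjI) auto
      moreover have "x \<in> ball x0 \<rho>" using s \<open>L < \<rho>\<close> by (simp add: dist_norm norm_mult)
      ultimately show "x \<in> U" using assms(8) by blast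
    qed
    show "cmod (x - x0) \<le> L" if "x \<in> J" for x using that in_J[of x] by (auto simp: norm_mult)
    show "cmod (x - x0) \<le> K * cmod (z - x)" if "x \<in> J" "z \<notin> U" "cmod (z - x0) < \<rho>" for x z
    proof -
      \<comment> \<open>Within \<open>\<rho>\<close> of \<open>x0\<close> the sector lies in
        \<open>U\<close>, so the cone condition applies to every point outside \<open>U\<close>
        there.\<close>
      have "z \<notin> sector x0 \<theta>0 \<beta>" using that assms(8) by (auto simp: dist_norm norm_minus_commute)
      then show ?thesis using assms(12) that unfolding J_def by blast
    qed
  qed (rule assms)+
  \<comment> \<open>Distances at most \<open>L\<close> keep the sequence on \<open>J\<close>, and at
    most \<open>\<sigma> / 2\<close> keep it in the range of the oscillation estimate.\<close>
  define q where "q n = min L (\<sigma> / 2) * inverse (real (Suc n))" for n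
  have q: "0 < q n" "q n \<le> min L (\<sigma> / 2)" for n
  proof -
    have m: "0 < min L (\<sigma> / 2)" using \<sigma>(1) \<open>0 < L\<close> by simp
    then show "0 < q n" by (simp add: q_def)
    have "min L (\<sigma> / 2) * inverse (real (Suc n)) \<le> min L (\<sigma> / 2) * 1"
      using m by (intro mult_left_mono) (auto simp: inverse_le_1_iff)
    then show "q n \<le> min L (\<sigma> / 2)" by (simp add: q_def)
  qed
  define Y where "Y n = x0 + of_real (q n) * cis \<theta>0" for n
  have Yn: "cmod (Y n - x0) = q n" for n using q(1)[of n] by (simp add: Y_def norm_mult)
  have "\<exists>C>0. \<forall>f \<in> A_alpha \<alpha> U. \<exists>v. is_bpd_ext \<alpha> U x0 t f v \<and>
     (\<forall>x \<in> J. x \<noteq> x0 \<longrightarrow> cmod ((deriv ^^ t) f x - v) / cmod (x - x0) powr lam \<le> C * lip_norm \<alpha> f)"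
  proof (rule bounded_point_derivation[of Y])
    show "Y n \<in> J - {x0}" for n
    proof -
      have "Y n \<in> J" unfolding in_J using q[of n] by (intro exI[of _ "q n"]) (auto simp: Y_def)
      moreover have "Y n \<noteq> x0" using Yn[of n] q(1)[of n] by auto
      ultimately show ?thesis by simp
    qed
    show "cmod (Y n - x0) \<le> \<sigma> / 2" for n using Yn[of n] q(2)[of n] by simp
    have "q \<longlonglongrightarrow> min L (\<sigma> / 2) * 0" unfolding q_def by (intro tendsto_intros LIMSEQ_inverse_real_of_nat)
    then have "Y \<longlonglongrightarrow> x0 + of_real 0 * cis \<theta>0" unfolding Y_def by (intro tendsto_intros) simp
    then show "Y \<longlonglongrightarrow> x0" by simp
  qed
  then show ?thesis unfolding J_def .
qed

end
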